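(* Assume that $D[0,\tau]=\sum_{i=0}^{\tau}D_i$ has finite mean and either (i) is bounded, or (ii) is unbounded and $\lim_{x\to\infty}\mathbb{E}\big[D[0,\tau]-x\,\big|\,D[0,\tau]>x\big]/x=0$. For each $p>0$ let $S^*(p)=\inf\{S:\mathbb{P}(D[0,\tau]\le S)\ge\frac{p}{p+h}\}$, let $U^*=U^*(p)\in\operatorname{argmin}_{U\ge 0}C(\mathrm{P}^U)$, and let $C^*=C^*(p)$ be the optimal cost-rate of the lost sales system. Then, with $h$, $\tau$ and the demand distribution fixed, $$\lim_{p\to\infty}\frac{C(\mathrm{P}^{(S^*(p)-\tau\mu)^+})}{C^*}=\lim_{p\to\infty}\frac{C(\mathrm{P}^{U^*})}{C^*}=1.$$
   Context: Lost sales inventory system. Periods are $t\in\mathbb{N}_0=\{0,1,2,\dots\}$; $\tau\in\mathbb{N}_0$ is the lead time, $h>0$ the holding cost and $p>0$ the lost sales penalty cost. Demands $D_0,D_1,\dots$ are i.i.d. nonnegative random variables with $\mu=\mathbb{E}[D_t]<\infty$. $q_t\ge 0$ is the order arriving at the start of period $t$; the order $q_{t+\tau}$ is placed in period $t$, before $D_t$ is observed. $I_t$ is the inventory at the start of period $t$ after receiving $q_t$. With $(x)^+=\max(0,x)$, the dynamics are $L_t=(D_t-I_t)^+$ (lost sales), $J_t=(I_t-D_t)^+$ (end-of-period inventory), $I_t=J_{t-1}+q_t$. The state in period $t$ is $\mathbf{x}_t=(I_t,q_{t+1},\dots,q_{t+\tau-1})\in\mathbb{R}_+^\tau$ (for $\tau=0$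 it is the inventory $J_{t-1}$ before ordering). A policy $\mathrm{A}=\{\mathrm{A}_t\}_{t\in\mathbb{N}_0}$ is a sequence of (measurable) functions setting $q_{t+\tau}=\mathrm{A}_t(\mathbf{x}_t)\ge 0$. The initial state is $\mathbf{x}_0=\mathbf{0}$, i.e. $I_0=0$ and $q_t=0$ for $t<\tau$ (for $\tau=0$: $J_{-1}=0$). The projected inventory level (PIL) policy $\mathrm{P}^U$, $U\ge0$, is $\mathrm{P}^U_t(\mathbf{x}_t)=(U-\mathbb{E}[J_{t+\tau-1}\mid\mathbf{x}_t])^+$. The cost in period $t$ is $c_t=hJ_t+pL_t$, and the cost-rate of a policy $\mathrm{A}$ is $C(\mathrm{A})=\limsup_{T\to\infty}\mathbb{E}\big[\frac{1}{T-\tau+1}\sum_{t=\tau}^T c_t\big]$, with costs incurred under $\mathrm{A}$. $C^*$ is the long-run expected cost-rate of an optimal policy, i.e. the infimum of $C(\mathrm{A})$ over all policies. The ratios presuppose $C^*>0$. *)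

theory Defs
  imports "HOL-Probability.Probability"
begin

text \<open>Sample paths for an order sequence \<open>q\<close> (\<open>q t\<close> arrives at the start of period \<open>t\<close>)
  and a demand sequence \<open>d\<close>, with \<open>J\<close> equal to 0 before period 0.\<close>

primrec inventory :: "(nat \<Rightarrow> real) \<Rightarrow> (nat \<Rightarrow> real) \<Rightarrow> nat \<Rightarrow> real" where
  "inventory q d 0 = q 0"
| "inventory q d (Suc t) = max 0 (inventory q d t - d t) + q (Suc t)"

definition end_inventory :: "(nat \<Rightarrow> real) \<Rightarrow> (nat \<Rightarrow> real) \<Rightarrow> nat \<Rightarrow> real" where
  "end_inventory q d t = max 0 (inventory q d t - d t)"

definition lost_sales :: "(nat \<Rightarrow> real) \<Rightarrow> (nat \<Rightarrow> real) \<Rightarrow> nat \<Rightarrow> real" where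
  "lost_sales q d t = max 0 (d t - inventory q d t)"

text \<open>States are nonnegative vectors indexed by \<open>{..<max 1 \<tau>}\<close>: for \<open>\<tau> \<ge> 1\<close> the vector
  \<open>(I\<^sub>t, q\<^sub>t\<^sub>+\<^sub>1, \<dots>, q\<^sub>t\<^sub>+\<^sub>\<tau>\<^sub>-\<^sub>1)\<close>, and for \<open>\<tau> = 0\<close> the single number \<open>J\<^sub>t\<^sub>-\<^sub>1\<close>.\<close>

definition state_space :: "nat \<Rightarrow> (nat \<Rightarrow> real) measure" where
  "state_space \<tau> = (\<Pi>\<^sub>M i\<in>{..<max 1 \<tau>}. restrict_space borel {0..})"

definition state :: "nat \<Rightarrow> (nat \<Rightarrow> real) \<Rightarrow> (nat \<Rightarrow> real) \<Rightarrow> nat \<Rightarrow> nat \<Rightarrow> real" where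
  "state \<tau> q d t = (\<lambda>i\<in>{..<max 1 \<tau>}.
     if \<tau> = 0 then (case t of 0 \<Rightarrow> 0 | Suc s \<Rightarrow> end_inventory q d s)
     else if i = 0 then inventory q d t else q (t + i))"

type_synonym policy = "nat \<Rightarrow> (nat \<Rightarrow> real) \<Rightarrow> real"

definition policies :: "nat \<Rightarrow> policy set" where
  "policies \<tau> = {A. \<forall>t. A t \<in> state_space \<tau> \<rightarrow>\<^sub>M restrict_space borel {0..}}"

text \<open>The state in period \<open>t - \<tau>\<close> involves only orders arriving before period \<open>t\<close>; the
  congruence rules make this available to the termination proof of \<open>order_seq\<close>.\<close>

lemma inventory_cong:
  assumes "\<And>s. s \<le> t \<Longrightarrow> q s = q' s" "\<And>s. s < t \<Longrightarrow> d s = d' s"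
  shows "inventory q d t = inventory q' d' t"
  using assms by (induction t) auto

lemma end_inventory_cong:
  assumes "\<And>s. s \<le> t \<Longrightarrow> q s = q' s" "\<And>s. s \<le> t \<Longrightarrow> d s = d' s"
  shows "end_inventory q d t = end_inventory q' d' t"
  using assms inventory_cong[of t q q' d d'] by (simp add: end_inventory_def)

lemma state_cong:
  assumes "\<And>s. s < \<tau> + t \<Longrightarrow> q s = q' s" "\<And>s. s < t \<Longrightarrow> d s = d' s"
  shows "state \<tau> q d t = state \<tau> q' d' t"
proof (cases "\<tau> = 0")
  case True
  have "end_inventory q d s = end_inventory q' d' s" if "t = Suc s" for s
    using assms True that by (intro end_inventory_cong) auto
  with True show ?thesis
    by (cases t) (auto simp: state_def)
next
  case False
  then have "inventory q d t = inventory q' d' t"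
    using assms by (intro inventory_cong) auto
  with False assms show ?thesis
    by (auto simp: state_def fun_eq_iff restrict_def)
qed

lemma state_fundef_cong [fundef_cong]:
  assumes "\<tau> = \<tau>'" "t = t'" "d = d'" "\<And>s. s < \<tau>' + t' \<Longrightarrow> q s = q' s"
  shows "state \<tau> q d t = state \<tau>' q' d' t'"
  using assms state_cong by blast

fun order_seq :: "nat \<Rightarrow> policy \<Rightarrow> (nat \<Rightarrow> real) \<Rightarrow> nat \<Rightarrow> real" where
  "order_seq \<tau> A d t =
    (if t < \<tau> then 0 else A (t - \<tau>) (state \<tau> (\<lambda>s. order_seq \<tau> A d s) d (t - \<tau>)))"

declare order_seq.simps [simp del]

definition cost_rate ::
  "'a measure \<Rightarrow> (nat \<Rightarrow> 'a \<Rightarrow> real) \<Rightarrow> nat \<Rightarrow> real \<Rightarrow> real \<Rightarrow> policy \<Rightarrow> ennreal" where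
  "cost_rate M D \<tau> h p A = limsup (\<lambda>T. \<integral>\<^sup>+ \<omega>. ennreal (
     let d = (\<lambda>t. D t \<omega>); q = order_seq \<tau> A d
     in 1 / (real T - real \<tau> + 1) *
        (\<Sum>t=\<tau>..T. h * end_inventory q d t + p * lost_sales q d t)) \<partial>M)"

definition optimal_cost_rate ::
  "'a measure \<Rightarrow> (nat \<Rightarrow> 'a \<Rightarrow> real) \<Rightarrow> nat \<Rightarrow> real \<Rightarrow> real \<Rightarrow> ennreal" where
  "optimal_cost_rate M D \<tau> h p = (INF A\<in>policies \<tau>. cost_rate M D \<tau> h p A)"

text \<open>\<open>projected_inventory M D \<tau> t x\<close> is the conditional expectation of \<open>J\<^sub>t\<^sub>+\<^sub>\<tau>\<^sub>-\<^sub>1\<close> given that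
  the state in period \<open>t\<close> is \<open>x\<close>, as a function of \<open>x\<close>. For \<open>\<tau> \<ge> 1\<close> the system is restarted in
  period \<open>t\<close> with the state \<open>x\<close> as its order sequence (inventory \<open>x 0\<close>, arrivals
  \<open>x 1, \<dots>, x (\<tau> - 1)\<close>) and runs for \<open>\<tau>\<close> periods. The lemma \<open>projected_inventory_cond_exp\<close>
  below identifies it with the conditional expectation of the library.\<close>

definition projected_inventory ::
  "'a measure \<Rightarrow> (nat \<Rightarrow> 'a \<Rightarrow> real) \<Rightarrow> nat \<Rightarrow> nat \<Rightarrow> (nat \<Rightarrow> real) \<Rightarrow> real" where
  "projected_inventory M D \<tau> t x =
     (if \<tau> = 0 then x 0
      else LINT \<omega>|M. end_inventory x (\<lambda>i. D (t + i) \<omega>) (\<tau> - 1))"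

definition pil_policy :: "'a measure \<Rightarrow> (nat \<Rightarrow> 'a \<Rightarrow> real) \<Rightarrow> nat \<Rightarrow> real \<Rightarrow> policy" where
  "pil_policy M D \<tau> U = (\<lambda>t x. max 0 (U - projected_inventory M D \<tau> t x))"

definition lead_time_demand :: "(nat \<Rightarrow> 'a \<Rightarrow> real) \<Rightarrow> nat \<Rightarrow> 'a \<Rightarrow> real" where
  "lead_time_demand D \<tau> \<omega> = (\<Sum>i=0..\<tau>. D i \<omega>)"

definition newsvendor_level ::
  "'a measure \<Rightarrow> (nat \<Rightarrow> 'a \<Rightarrow> real) \<Rightarrow> nat \<Rightarrow> real \<Rightarrow> real \<Rightarrow> real" where
  "newsvendor_level M D \<tau> h p =
     Inf {S. measure M {\<omega>\<in>space M. lead_time_demand D \<tau> \<omega> \<le> S} \<ge> p / (p + h)}"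

definition mean_excess :: "'a measure \<Rightarrow> ('a \<Rightarrow> real) \<Rightarrow> real \<Rightarrow> real" where
  "mean_excess M X x = (LINT \<omega>|uniform_measure M {\<omega>\<in>space M. X \<omega> > x}. X \<omega> - x)"

definition ess_bounded :: "'a measure \<Rightarrow> ('a \<Rightarrow> real) \<Rightarrow> bool" where
  "ess_bounded M X \<longleftrightarrow> (\<exists>B. AE \<omega> in M. \<bar>X \<omega>\<bar> \<le> B)"

lemma inventory_measurable:
  assumes "\<And>s. s \<le> t \<Longrightarrow> (\<lambda>\<omega>. Q \<omega> s) \<in> borel_measurable N"
    "\<And>s. s < t \<Longrightarrow> (\<lambda>\<omega>. E \<omega> s) \<in> borel_measurable N"
  shows "(\<lambda>\<omega>. inventory (Q \<omega>) (E \<omega>) t) \<in> borel_measurable N"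
  using assms
proof (induction t)
  case (Suc t)
  have "(\<lambda>\<omega>. inventory (Q \<omega>) (E \<omega>) t) \<in> borel_measurable N"
    by (intro Suc.IH Suc.prems) auto
  moreover have "(\<lambda>\<omega>. E \<omega> t) \<in> borel_measurable N" by (rule Suc.prems) simp
  moreover have "(\<lambda>\<omega>. Q \<omega> (Suc t)) \<in> borel_measurable N" by (rule Suc.prems) simp
  ultimately show ?case by simp
qed simp

lemma end_inventory_measurable:
  assumes "\<And>s. s \<le> t \<Longrightarrow> (\<lambda>\<omega>. Q \<omega> s) \<in> borel_measurable N"
    "\<And>s. s \<le> t \<Longrightarrow> (\<lambda>\<omega>. E \<omega> s) \<in> borel_measurable N"
  shows "(\<lambda>\<omega>. end_inventory (Q \<omega>) (E \<omega>) t) \<in> borel_measurable N"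
  using assms unfolding end_inventory_def
  by (intro borel_measurable_max borel_measurable_diff inventory_measurable) auto

lemma inventory_nonneg:
  "(\<And>s. s \<le> t \<Longrightarrow> 0 \<le> q s) \<Longrightarrow> 0 \<le> inventory q d t"
  by (cases t) (auto intro: add_nonneg_nonneg)

lemma end_inventory_nonneg: "0 \<le> end_inventory q d t"
  by (simp add: end_inventory_def)

lemma state_measurable:
  assumes "\<And>s. s < \<tau> + t \<Longrightarrow> (\<lambda>\<omega>. Q \<omega> s) \<in> N \<rightarrow>\<^sub>M restrict_space borel {0::real..}"
    "\<And>s. s < t \<Longrightarrow> (\<lambda>\<omega>. E \<omega> s) \<in> borel_measurable N"
  shows "(\<lambda>\<omega>. state \<tau> (Q \<omega>) (E \<omega>) t) \<in> N \<rightarrow>\<^sub>M state_space \<tau>"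
  unfolding state_def state_space_def
proof (rule measurable_restrict)
  fix i assume i: "i \<in> {..<max 1 \<tau>}"
  have Q: "(\<lambda>\<omega>. Q \<omega> s) \<in> borel_measurable N" "\<And>\<omega>. \<omega> \<in> space N \<Longrightarrow> 0 \<le> Q \<omega> s"
    if "s < \<tau> + t" for s
    using assms(1)[OF that] by (auto simp: measurable_restrict_space2_iff)
  show "(\<lambda>\<omega>. if \<tau> = 0 then (case t of 0 \<Rightarrow> 0 | Suc s \<Rightarrow> end_inventory (Q \<omega>) (E \<omega>) s)
     else if i = 0 then inventory (Q \<omega>) (E \<omega>) t else Q \<omega> (t + i))
     \<in> N \<rightarrow>\<^sub>M restrict_space borel {0::real..}"
    using i Q assms(2)
    by (cases "\<tau> = 0"; cases "i = 0"; cases t)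
       (auto simp: measurable_restrict_space2_iff end_inventory_nonneg simp del: inventory.simps
        intro!: end_inventory_measurable inventory_measurable inventory_nonneg)
qed

lemma order_measurable:
  assumes "A \<in> policies \<tau>" "\<And>s. (\<lambda>\<omega>. E \<omega> s) \<in> borel_measurable N"
  shows "(\<lambda>\<omega>. order_seq \<tau> A (E \<omega>) t) \<in> N \<rightarrow>\<^sub>M restrict_space borel {0::real..}"
proof (induction t rule: less_induct)
  case (less t)
  show ?case
  proof (cases "t < \<tau>")
    case True
    then show ?thesis by (simp add: order_seq.simps measurable_restrict_space2_iff)
  next
    case False
    have "(\<lambda>\<omega>. state \<tau> (order_seq \<tau> A (E \<omega>)) (E \<omega>) (t - \<tau>)) \<in> N \<rightarrow>\<^sub>M state_space \<tau>"
      using less False assms(2) by (intro state_measurable) auto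
    from measurable_compose[OF this, of "A (t - \<tau>)"] assms(1) False
    show ?thesis by (subst order_seq.simps) (simp add: policies_def)
  qed
qed

lemma order_cong:
  "(\<And>s. s < t - \<tau> \<Longrightarrow> d s = d' s) \<Longrightarrow> order_seq \<tau> A d t = order_seq \<tau> A d' t"
proof (induction t rule: less_induct)
  case (less t)
  show ?case
  proof (cases "t < \<tau>")
    case False
    have "state \<tau> (order_seq \<tau> A d) d (t - \<tau>) = state \<tau> (order_seq \<tau> A d') d' (t - \<tau>)"
      using less False by (intro state_cong) auto
    with False show ?thesis by (simp add: order_seq.simps[of \<tau> A _ t])
  qed (simp add: order_seq.simps)
qed

lemma inventory_restart:
  "inventory q d (t + k) =
    inventory (\<lambda>i. if i = 0 then inventory q d t else q (t + i)) (\<lambda>i. d (t + i)) k"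
  by (induction k) auto

lemma end_inventory_restart:
  assumes "0 < \<tau>"
  shows "end_inventory q d (t + (\<tau> - 1)) =
    end_inventory (state \<tau> q d t) (\<lambda>i. d (t + i)) (\<tau> - 1)"
proof -
  have "end_inventory q d (t + (\<tau> - 1)) =
      end_inventory (\<lambda>i. if i = 0 then inventory q d t else q (t + i)) (\<lambda>i. d (t + i)) (\<tau> - 1)"
    by (simp add: end_inventory_def inventory_restart)
  also have "\<dots> = end_inventory (state \<tau> q d t) (\<lambda>i. d (t + i)) (\<tau> - 1)"
    using assms by (intro end_inventory_cong) (auto simp: state_def)
  finally show ?thesis .
qed

lemma integral_indep_pair:
  fixes f :: "'b \<times> 'b \<Rightarrow> real"
  assumes "prob_space M" "prob_space.indep_var M S X T Y"
    and f [measurable]: "f \<in> borel_measurable (S \<Otimes>\<^sub>M T)"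
    and int: "integrable M (\<lambda>\<omega>. f (X \<omega>, Y \<omega>))"
  shows "integrable M (\<lambda>\<omega>. LINT \<omega>'|M. f (X \<omega>, Y \<omega>'))"
    and "(LINT \<omega>|M. f (X \<omega>, Y \<omega>)) = (LINT \<omega>|M. LINT \<omega>'|M. f (X \<omega>, Y \<omega>'))"
proof -
  interpret prob_space M by fact
  have X [measurable]: "X \<in> M \<rightarrow>\<^sub>M S" and Y [measurable]: "Y \<in> M \<rightarrow>\<^sub>M T"
    and eq: "distr M S X \<Otimes>\<^sub>M distr M T Y = distr M (S \<Otimes>\<^sub>M T) (\<lambda>x. (X x, Y x))"
    using assms(2) by (auto simp: indep_var_distribution_eq)
  interpret X: prob_space "distr M S X" by (rule prob_space_distr) fact
  interpret Y: prob_space "distr M T Y" by (rule prob_space_distr) fact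
  interpret XY: pair_prob_space "distr M S X" "distr M T Y" ..
  have ip: "integrable (distr M S X \<Otimes>\<^sub>M distr M T Y) f"
    unfolding eq using int by (subst integrable_distr_eq) auto
  have inner: "(LINT y|distr M T Y. f (x, y)) = (LINT \<omega>'|M. f (x, Y \<omega>'))" if "x \<in> space S" for x
    using that by (subst integral_distr) auto
  have meas: "(\<lambda>x. LINT y|distr M T Y. f (x, y)) \<in> borel_measurable S"
    using ip by (auto intro!: Y.borel_measurable_lebesgue_integral)
  have "integrable (distr M S X) (\<lambda>x. LINT y|distr M T Y. f (x, y))"
    using XY.integrable_fst'[OF ip] by simp
  then have "integrable M (\<lambda>\<omega>. LINT y|distr M T Y. f (X \<omega>, y))"
    using meas by (subst (asm) integrable_distr_eq) auto
  then show "integrable M (\<lambda>\<omega>. LINT \<omega>'|M. f (X \<omega>, Y \<omega>'))"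
    using measurable_space[OF X] by (subst (asm) Bochner_Integration.integrable_cong[OF refl inner]) auto
  have "(LINT \<omega>|M. f (X \<omega>, Y \<omega>)) = (LINT z|(distr M S X \<Otimes>\<^sub>M distr M T Y). f z)"
    unfolding eq by (subst integral_distr) auto
  also have "\<dots> = (LINT x|distr M S X. LINT y|distr M T Y. f (x, y))"
    using XY.integral_fst'[OF ip] by simp
  also have "\<dots> = (LINT \<omega>|M. LINT y|distr M T Y. f (X \<omega>, y))"
    using meas by (subst integral_distr) auto
  also have "\<dots> = (LINT \<omega>|M. LINT \<omega>'|M. f (X \<omega>, Y \<omega>'))"
    using measurable_space[OF X] by (intro Bochner_Integration.integral_cong refl inner) auto
  finally show "(LINT \<omega>|M. f (X \<omega>, Y \<omega>)) = (LINT \<omega>|M. LINT \<omega>'|M. f (X \<omega>, Y \<omega>'))" .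
qed

lemma end_inventory_pair_measurable:
  assumes "0 < \<tau>" "\<And>i. i < \<tau> \<Longrightarrow> (\<lambda>y. E y i) \<in> borel_measurable T"
  shows "(\<lambda>(x, y). end_inventory x (E y) (\<tau> - 1)) \<in> borel_measurable (state_space \<tau> \<Otimes>\<^sub>M T)"
  unfolding case_prod_beta
proof (rule end_inventory_measurable)
  fix s assume s: "s \<le> \<tau> - 1"
  have "(\<lambda>x. x s) \<in> state_space \<tau> \<rightarrow>\<^sub>M restrict_space borel {0..}"
    using s assms(1) unfolding state_space_def by (intro measurable_component_singleton) auto
  then have "(\<lambda>x. x s) \<in> borel_measurable (state_space \<tau>)"
    by (simp add: measurable_restrict_space2_iff)
  from measurable_compose[OF measurable_fst this]
  show "(\<lambda>z. fst z s) \<in> borel_measurable (state_space \<tau> \<Otimes>\<^sub>M T)" .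
  show "(\<lambda>z. E (snd z) s) \<in> borel_measurable (state_space \<tau> \<Otimes>\<^sub>M T)"
    using s assms by (intro measurable_compose[OF measurable_snd]) auto
qed

lemma projected_inventory_measurable:
  assumes "prob_space M" "\<And>t. D t \<in> borel_measurable M"
  shows "projected_inventory M D \<tau> t \<in> borel_measurable (state_space \<tau>)"
proof (cases "\<tau> = 0")
  case True
  have "(\<lambda>x. x 0) \<in> state_space \<tau> \<rightarrow>\<^sub>M restrict_space borel {0..}"
    unfolding state_space_def by (intro measurable_component_singleton) auto
  with True show ?thesis
    by (simp add: projected_inventory_def[abs_def] measurable_restrict_space2_iff)
next
  case False
  interpret prob_space M by fact
  have "(\<lambda>(x, \<omega>). end_inventory x (\<lambda>i. D (t + i) \<omega>) (\<tau> - 1))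
      \<in> borel_measurable (state_space \<tau> \<Otimes>\<^sub>M M)"
    using False assms(2) by (intro end_inventory_pair_measurable) auto
  from borel_measurable_lebesgue_integral[OF this] False show ?thesis
    by (simp add: projected_inventory_def[abs_def])
qed

lemma pil_policy_in_policies:
  assumes "prob_space M" "\<And>t. D t \<in> borel_measurable M"
  shows "pil_policy M D \<tau> U \<in> policies \<tau>"
  using projected_inventory_measurable[OF assms]
  by (auto simp: policies_def pil_policy_def measurable_restrict_space2_iff)

lemma projected_inventory_cond_exp:
  fixes M :: "'a measure" and D :: "nat \<Rightarrow> 'a \<Rightarrow> real" and A :: policy and \<tau> t :: nat
  defines "d \<equiv> \<lambda>\<omega> s. D s \<omega>"
  defines "x \<equiv> \<lambda>\<omega>. state \<tau> (order_seq \<tau> A (d \<omega>)) (d \<omega>) t"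
  defines "J \<equiv> \<lambda>\<omega>. end_inventory (order_seq \<tau> A (d \<omega>)) (d \<omega>) (t + \<tau> - 1)"
  assumes "prob_space M" "prob_space.indep_vars M (\<lambda>_. borel) D UNIV"
    and "A \<in> policies \<tau>" "0 < \<tau>" "integrable M J"
  shows "AE \<omega> in M. real_cond_exp M (vimage_algebra (space M) x (state_space \<tau>)) J \<omega>
           = projected_inventory M D \<tau> t (x \<omega>)"
proof -
  interpret prob_space M by fact
  let ?F = "vimage_algebra (space M) x (state_space \<tau>)"
  let ?T = "Pi\<^sub>M {t..<t + \<tau>} (\<lambda>_. borel) :: (nat \<Rightarrow> real) measure"
  let ?P = "Pi\<^sub>M {..<t} (\<lambda>_. borel) :: (nat \<Rightarrow> real) measure"
  define Y where "Y = (\<lambda>\<omega>. restrict (\<lambda>i. D i \<omega>) {t..<t + \<tau>})"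
  define E where "E = (\<lambda>(w :: nat \<Rightarrow> real) s. if s < t then w s else 0)"
  define g where "g = (\<lambda>w. state \<tau> (order_seq \<tau> A (E w)) (E w) t)"
  define f where "f = (\<lambda>(z, y). end_inventory z (\<lambda>i. y (t + i) :: real) (\<tau> - 1))"
  have D [measurable]: "D s \<in> borel_measurable M" for s
    using assms(5) by (auto simp: indep_vars_def)
  have xg: "x \<omega> = g (restrict (\<lambda>i. D i \<omega>) {..<t})" for \<omega>
    unfolding x_def g_def d_def E_def
    by (intro state_cong order_cong) auto
  have "(\<lambda>w. E w s) \<in> borel_measurable ?P" for s
    unfolding E_def by (cases "s < t") (auto intro!: measurable_component_singleton)
  then have g: "g \<in> ?P \<rightarrow>\<^sub>M state_space \<tau>"
    unfolding g_def using assms(6) by (intro state_measurable order_measurable) auto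
  have "indep_var ?P (\<lambda>\<omega>. restrict (\<lambda>i. D i \<omega>) {..<t}) ?T Y"
    unfolding Y_def by (rule indep_var_restrict[OF assms(5)]) auto
  from indep_var_compose[OF this g measurable_ident_sets[OF refl]]
  have ind: "indep_var (state_space \<tau>) x ?T Y"
    by (simp add: comp_def xg[symmetric])
  then have x [measurable]: "x \<in> M \<rightarrow>\<^sub>M state_space \<tau>" by (rule indep_var_rv1)
  have f [measurable]: "f \<in> borel_measurable (state_space \<tau> \<Otimes>\<^sub>M ?T)"
    unfolding f_def using assms(7)
    by (intro end_inventory_pair_measurable) (auto intro!: measurable_component_singleton)
  have Jf: "J \<omega> = f (x \<omega>, Y \<omega>)" for \<omega>
  proof -
    have "J \<omega> = end_inventory (x \<omega>) (\<lambda>i. d \<omega> (t + i)) (\<tau> - 1)"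
      using end_inventory_restart[OF assms(7), of _ _ t] assms(7) by (simp add: J_def x_def)
    also have "\<dots> = f (x \<omega>, Y \<omega>)"
      using assms(7) by (auto simp: f_def Y_def d_def intro!: end_inventory_cong)
    finally show ?thesis .
  qed
  have pf: "projected_inventory M D \<tau> t z = (LINT \<omega>'|M. f (z, Y \<omega>'))" for z
    using assms(7)
    by (auto simp: f_def Y_def projected_inventory_def
        intro!: Bochner_Integration.integral_cong end_inventory_cong)
  have J: "J = (\<lambda>\<omega>. f (x \<omega>, Y \<omega>))" by (simp add: Jf fun_eq_iff)
  have x_space: "x \<in> space M \<rightarrow> space (state_space \<tau>)"
    using measurable_space[OF x] by auto
  have sub: "subalgebra M ?F"
    using measurable_sets[OF x] x_space
    by (auto simp: subalgebra_def sets_vimage_algebra2)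
  interpret finite_measure_subalgebra M ?F
    by unfold_locales (use sub in auto)
  show ?thesis
  proof (rule real_cond_exp_charact)
    show "integrable M J" by fact
    show "integrable M (\<lambda>\<omega>. projected_inventory M D \<tau> t (x \<omega>))"
      unfolding pf using integral_indep_pair(1)[OF assms(4) ind f] assms(8) by (simp add: J)
    show "(\<lambda>\<omega>. projected_inventory M D \<tau> t (x \<omega>)) \<in> borel_measurable ?F"
      by (rule measurable_compose[OF measurable_vimage_algebra1[OF x_space]
            projected_inventory_measurable[OF assms(4) D]])
    fix C assume "C \<in> sets ?F"
    then obtain B where B [measurable]: "B \<in> sets (state_space \<tau>)" and C: "C = x -` B \<inter> space M"
      using x_space by (auto simp: sets_vimage_algebra2)
    define k where "k = (\<lambda>(z, y). indicator B z * f (z, y) :: real)"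
    have k: "k \<in> borel_measurable (state_space \<tau> \<Otimes>\<^sub>M ?T)"
      unfolding k_def by measurable
    have CM: "C \<in> sets M" unfolding C by measurable
    have ik: "indicator C \<omega> * J \<omega> = k (x \<omega>, Y \<omega>)" if "\<omega> \<in> space M" for \<omega>
      using that by (auto simp: k_def Jf C indicator_def)
    have "integrable M (\<lambda>\<omega>. indicator C \<omega> * J \<omega>)"
      using integrable_mult_indicator[OF CM assms(8)] by simp
    then have "integrable M (\<lambda>\<omega>. k (x \<omega>, Y \<omega>))"
      by (subst (asm) Bochner_Integration.integrable_cong[OF refl ik]) auto
    note * = integral_indep_pair(2)[OF assms(4) ind k this]
    have "(LINT \<omega>:C|M. J \<omega>) = (LINT \<omega>|M. k (x \<omega>, Y \<omega>))"
      unfolding set_lebesgue_integral_def using ik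
      by (intro Bochner_Integration.integral_cong) auto
    also have "\<dots> = (LINT \<omega>|M. LINT \<omega>'|M. k (x \<omega>, Y \<omega>'))" by (rule *)
    also have "\<dots> = (LINT \<omega>:C|M. projected_inventory M D \<tau> t (x \<omega>))"
      unfolding set_lebesgue_integral_def pf
      by (intro Bochner_Integration.integral_cong) (auto simp: k_def C indicator_def)
    finally show "(LINT \<omega>:C|M. J \<omega>) = (LINT \<omega>:C|M. projected_inventory M D \<tau> t (x \<omega>))" .
  qed
qed

end

theory Submission
  imports Defs "HOL-Real_Asymp.Real_Asymp"
begin

text \<open>Let \<open>X = D[0,\<tau>]\<close> and \<open>B p S = E[h (S - X)\<^sup>+ + p (X - S)\<^sup>+]\<close>, with minimiser \<open>S\<^sup>* p\<close> and
  minimum \<open>G p\<close>; this is the cost-rate of a base-stock policy in the backorder system.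

  Upper bound: if all orders still in the pipeline arrived one period earlier, sales could only
  increase, so under the projected inventory level policy the projected inventory never exceeds \<open>U\<close> and
  every order raises it to exactly \<open>U\<close>. The inventory in period \<open>t + \<tau>\<close> then has conditional mean
  \<open>U\<close>, and by Harris' inequality it is smaller in convex order than \<open>U + \<tau>\<mu> - D[t,t+\<tau>-1]\<close>. Hence
  the cost-rate is at most \<open>B p (U + \<tau>\<mu>)\<close>, which is \<open>G p\<close> for \<open>U = S\<^sup>* p - \<tau>\<mu>\<close>.

  Lower bound: under any policy, charging to each window of \<open>\<tau> + 1\<close> periods the holding cost of its last
  period and a fraction \<open>1 / (\<tau> + 1)\<close> of its penalties gives a newsvendor problem with penalty
  \<open>p / (\<tau> + 1)\<close>, so the optimal cost-rate is at least \<open>G (p / (\<tau> + 1))\<close>.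

  Finally \<open>G (k p) / G p\<close> tends to 1 for every \<open>k \<ge> 1\<close>. For bounded \<open>X\<close> the function \<open>G\<close> is monotone
  and bounded. For unbounded \<open>X\<close> with mean excess \<open>m\<close>, \<open>G (k p) - G p \<le> (k - 1) h m(S\<^sup>* p)\<close> while
  \<open>G p \<ge> h (S\<^sup>* p - E X)\<close> and \<open>S\<^sup>* p\<close> tends to infinity.\<close>

section \<open>Sample paths\<close>

text \<open>Unlike \<open>state\<close>, it contains the order \<open>q (t + \<tau>)\<close> placed
  in period \<open>t\<close>, so it carries the system through the whole window from
  \<open>t\<close> to \<open>t + \<tau>\<close>.\<close>

definition pipeline :: "(nat \<Rightarrow> real) \<Rightarrow> (nat \<Rightarrow> real) \<Rightarrow> nat \<Rightarrow> nat \<Rightarrow> real" where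
  "pipeline q d t = (\<lambda>i. if i = 0 then inventory q d t else q (t + i))"

lemma inventory_pipeline:
  "inventory q d (t + k) = inventory (pipeline q d t) (\<lambda>i. d (t + i)) k"
  unfolding pipeline_def by (rule inventory_restart)

lemma end_inventory_pipeline:
  "end_inventory q d (t + k) = end_inventory (pipeline q d t) (\<lambda>i. d (t + i)) k"
  by (simp add: end_inventory_def inventory_pipeline)

lemma lost_sales_pipeline:
  "lost_sales q d (t + k) = lost_sales (pipeline q d t) (\<lambda>i. d (t + i)) k"
  by (simp add: lost_sales_def inventory_pipeline)

lemma pipeline_nonneg: "(\<And>s. 0 \<le> q s) \<Longrightarrow> 0 \<le> pipeline q d t i"
  by (simp add: pipeline_def inventory_nonneg)

lemma lost_sales_nonneg: "0 \<le> lost_sales q d t"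
  by (simp add: lost_sales_def)

lemma inventory_antimono:
  "(\<And>s. s < t \<Longrightarrow> d s \<le> d' s) \<Longrightarrow> inventory q d' t \<le> inventory q d t"
proof (induction t)
  case (Suc t)
  then have "inventory q d' t \<le> inventory q d t" "d t \<le> d' t" by auto
  then show ?case by (auto simp: max_def)
qed simp

text \<open>Inventory plus past demand is what has arrived plus what has been lost, and larger
  demands lose at least as much.\<close>

lemma inventory_plus_demand_mono:
  "(\<And>s. s < t \<Longrightarrow> d s \<le> d' s) \<Longrightarrow>
    inventory q d t + (\<Sum>s<t. d s) \<le> inventory q d' t + (\<Sum>s<t. d' s)"
proof (induction t)
  case (Suc t)
  then have "inventory q d t + (\<Sum>s<t. d s) \<le> inventory q d' t + (\<Sum>s<t. d' s)" "d t \<le> d' t" by auto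
  \<comment> \<open>Since \<open>max 0 (I - d) + s + d = max (s + d) (s + I)\<close>, past demand
    has to be monotone as well as past demand plus inventory.\<close>
  moreover have "(\<Sum>s<t. d s) \<le> (\<Sum>s<t. d' s)" using Suc.prems by (intro sum_mono) auto
  ultimately show ?case by (auto simp: max_def)
qed simp

lemma inventory_le_sum:
  "(\<And>s. s \<le> t \<Longrightarrow> 0 \<le> q s) \<Longrightarrow> (\<And>s. s < t \<Longrightarrow> 0 \<le> d s) \<Longrightarrow> inventory q d t \<le> (\<Sum>s\<le>t. q s)"
proof (induction t)
  case (Suc t)
  then have "inventory q d t \<le> (\<Sum>s\<le>t. q s)" "0 \<le> d t" by auto
  moreover have "0 \<le> (\<Sum>s\<le>t. q s)" using Suc.prems by (intro sum_nonneg) auto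
  ultimately show ?case by (auto simp: max_def)
qed simp

text \<open>Conservation of stock: arrivals are either still held or have met demand, and the demand
  that was not met is the lost sales.\<close>

lemma end_inventory_balance:
  "end_inventory q d n = (\<Sum>i\<le>n. q i) - (\<Sum>i\<le>n. d i) + (\<Sum>i\<le>n. lost_sales q d i)"
proof (induction n)
  case (Suc n)
  have "end_inventory q d (Suc n) = end_inventory q d n + q (Suc n) - d (Suc n) + lost_sales q d (Suc n)"
    by (simp add: end_inventory_def lost_sales_def max_def)
  with Suc show ?case by simp
qed (simp add: end_inventory_def lost_sales_def max_def)

text \<open>Letting every order arrive one period earlier can only increase sales.\<close>

lemma early_arrival:
  assumes "0 \<le> d0" "x 0 \<le> max 0 (z 0 - d0) + z 1" "\<And>i. i < k \<Longrightarrow> x (Suc i) = z (Suc (Suc i))"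
    "\<And>i. 0 \<le> z i"
  shows "end_inventory x d k \<le> inventory z d (Suc k)"
proof -
  \<comment> \<open>Facing the same demands, the system started at \<open>x\<close> has received one
    arrival more than the one started at \<open>z\<close>, namely \<open>z (Suc k)\<close>, and is
    ahead by at most that amount.\<close>
  have "inventory x d k \<le> inventory z d k + z (Suc k)"
    using assms(3)
  proof (induction k)
    case 0
    with assms(1,2) assms(4)[of 0] show ?case by auto
  next
    case (Suc k)
    then have "inventory x d k \<le> inventory z d k + z (Suc k)" by simp
    with Suc.prems[of k] assms(4)[of "Suc k"] show ?case by (auto simp: max_def)
  qed
  with assms(4)[of "Suc k"] show ?thesis by (auto simp: end_inventory_def max_def)
qed

section \<open>Harris' inequality\<close>

text \<open>Integrate \<open>(f x - f y) * (g x - g y) \<ge> 0\<close> over \<open>x\<close> and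
  then over \<open>y\<close>; in this iterated form integrability of \<open>f\<close>,
  \<open>g\<close> and their product suffices.\<close>

lemma Chebyshev_integral_antimono:
  fixes f g :: "real \<Rightarrow> real"
  assumes "prob_space P" "antimono f" "antimono g" and f: "integrable P f" and g: "integrable P g"
    and fg: "integrable P (\<lambda>x. f x * g x)"
  shows "(LINT x|P. f x) * (LINT x|P. g x) \<le> (LINT x|P. f x * g x)"
proof -
  interpret prob_space P by fact
  define a b c where "a = (LINT x|P. f x)" and "b = (LINT x|P. g x)" and "c = (LINT x|P. f x * g x)"
  have nonneg: "0 \<le> (f x - f y) * (g x - g y)" for x y
  proof (cases "x \<le> y")
    case True
    then have "f y \<le> f x" "g y \<le> g x" using assms(2,3) by (auto simp: antimono_def)
    then show ?thesis by simp
  next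
    case False
    then have "f x \<le> f y" "g x \<le> g y" using assms(2,3) by (auto simp: antimono_def)
    then show ?thesis by (simp add: mult_nonpos_nonpos)
  qed
  have "0 \<le> c - f y * b - g y * a + f y * g y" for y
  proof -
    have "0 \<le> (LINT x|P. (f x - f y) * (g x - g y))"
      by (intro integral_nonneg_AE AE_I2 nonneg)
    also have "(\<lambda>x. (f x - f y) * (g x - g y)) = (\<lambda>x. f x * g x - f y * g x - g y * f x + f y * g y)"
      by (simp add: algebra_simps)
    also have "(LINT x|P. f x * g x - f y * g x - g y * f x + f y * g y) = c - f y * b - g y * a + f y * g y"
      using f g fg by (simp add: a_def b_def c_def prob_space)
    finally show ?thesis .
  qed
  then have "0 \<le> (LINT y|P. c - f y * b - g y * a + f y * g y)"
    by (intro integral_nonneg_AE AE_I2)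
  also have "\<dots> = c - a * b - b * a + c"
    using f g fg by (simp add: a_def b_def c_def prob_space)
  finally show ?thesis by (simp add: a_def b_def c_def algebra_simps)
qed

text \<open>Induction on the coordinates: averaging out coordinate \<open>i\<close> turns
  \<open>f\<close> and \<open>g\<close> into antitone functions \<open>F\<close> and
  \<open>G\<close> of the others, and with the others fixed the one-dimensional inequality applies
  in \<open>i\<close>.\<close>

lemma Harris_bounded:
  fixes f g :: "('i \<Rightarrow> real) \<Rightarrow> real"
  assumes P: "prob_space P" "sets P = sets borel" and "finite I"
    and "f \<in> borel_measurable (Pi\<^sub>M I (\<lambda>_. P))" "g \<in> borel_measurable (Pi\<^sub>M I (\<lambda>_. P))"
    and "\<And>x y. (\<And>i. i \<in> I \<Longrightarrow> x i \<le> y i) \<Longrightarrow> f y \<le> f x"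
    and "\<And>x y. (\<And>i. i \<in> I \<Longrightarrow> x i \<le> y i) \<Longrightarrow> g y \<le> g x"
    and "\<And>x. \<bar>f x\<bar> \<le> B" "\<And>x. \<bar>g x\<bar> \<le> B"
  shows "(LINT x|Pi\<^sub>M I (\<lambda>_. P). f x) * (LINT x|Pi\<^sub>M I (\<lambda>_. P). g x)
    \<le> (LINT x|Pi\<^sub>M I (\<lambda>_. P). f x * g x)"
  using assms(3-)
proof (induction I arbitrary: f g)
  case empty
  interpret prob_space "Pi\<^sub>M ({}::'i set) (\<lambda>_. P)" using P by (intro prob_space_PiM) auto
  \<comment> \<open>With no coordinates the monotonicity hypotheses compare any two arguments in
    both directions, so \<open>f\<close> and \<open>g\<close> are constant.\<close>
  have "f x = f undefined" "g x = g undefined" for x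
    using empty.prems(3,4) by (auto intro!: antisym)
  then obtain a b where "f = (\<lambda>_. a)" "g = (\<lambda>_. b)" by (metis ext)
  then show ?case by (simp add: prob_space)
next
  case (insert i I)
  interpret P: prob_space P by fact
  interpret product_sigma_finite "\<lambda>_::'i. P" by unfold_locales
  interpret J: prob_space "Pi\<^sub>M (insert i I) (\<lambda>_. P)" using P by (intro prob_space_PiM) auto
  interpret I: prob_space "Pi\<^sub>M I (\<lambda>_. P)" using P by (intro prob_space_PiM) auto
  define B2 where "B2 = B * B"
  note meas [measurable] = insert.prems(1,2)
  have fgB: "\<bar>f x * g x\<bar> \<le> B2" for x
    using mult_mono[OF insert.prems(5)[of x] insert.prems(6)[of x]] insert.prems(5)[of x]
    by (auto simp: abs_mult B2_def)
  \<comment> \<open>Monotonicity in the coordinates of \<open>insert i I\<close> makes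
    \<open>k\<close> ignore all others. Any \<open>x\<close> may thus be replaced by its
    restriction, which lies in the space of the product measure.\<close>
  have eqI: "k x = k y" if "\<And>x y. (\<And>j. j \<in> insert i I \<Longrightarrow> x j \<le> y j) \<Longrightarrow> k y \<le> k x"
    "\<And>j. j \<in> insert i I \<Longrightarrow> x j = y j" for k :: "('i \<Rightarrow> real) \<Rightarrow> real" and x y
    using that by (intro antisym) auto
  have spaceP: "space P = UNIV" using sets_eq_imp_space_eq[OF P(2)] by simp
  have sec: "(\<lambda>y. k (x(i := y))) \<in> borel_measurable P"
    if "k \<in> borel_measurable (Pi\<^sub>M (insert i I) (\<lambda>_. P))"
      and k: "\<And>x y. (\<And>j. j \<in> insert i I \<Longrightarrow> x j \<le> y j) \<Longrightarrow> k y \<le> k x"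
    for k :: "('i \<Rightarrow> real) \<Rightarrow> real" and x
  proof -
    have "k (x(i := y)) = k ((restrict x I)(i := y))" for y
      by (rule eqI[OF k]) auto
    moreover have "(\<lambda>y. (restrict x I)(i := y)) \<in> P \<rightarrow>\<^sub>M Pi\<^sub>M (insert i I) (\<lambda>_. P)"
      using insert.hyps by (intro measurable_fun_upd[where J=I]) (auto simp: space_PiM spaceP)
    ultimately show ?thesis using measurable_compose[OF _ that(1)] by simp
  qed
  note secf [measurable] = sec[OF insert.prems(1,3)] and secg [measurable] = sec[OF insert.prems(2,4)]
  define F G where "F x = (LINT y|P. f (x(i := y)))" and "G x = (LINT y|P. g (x(i := y)))" for x
  have f: "integrable P (\<lambda>y. f (x(i := y)))" and g: "integrable P (\<lambda>y. g (x(i := y)))"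
    and fg: "integrable P (\<lambda>y. f (x(i := y)) * g (x(i := y)))" for x
    using insert.prems(5,6) fgB
    by (auto intro: P.integrable_const_bound[where B=B] P.integrable_const_bound[where B=B2])
  have joint: "(\<lambda>(x, y). x(i := y)) \<in> Pi\<^sub>M I (\<lambda>_. P) \<Otimes>\<^sub>M P \<rightarrow>\<^sub>M Pi\<^sub>M (insert i I) (\<lambda>_. P)"
    by (simp add: measurable_add_dim)
  have lift: "(\<lambda>x. LINT y|P. k (x(i := y))) \<in> borel_measurable (Pi\<^sub>M I (\<lambda>_. P))"
    if "k \<in> borel_measurable (Pi\<^sub>M (insert i I) (\<lambda>_. P))" for k :: "('i \<Rightarrow> real) \<Rightarrow> real"
    using measurable_compose[OF joint that]
    by (intro P.borel_measurable_lebesgue_integral) (simp add: case_prod_beta)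
  have FB: "\<bar>F x\<bar> \<le> B" and GB: "\<bar>G x\<bar> \<le> B" for x
  proof -
    have bound: "\<bar>LINT y|P. k (x(i := y))\<bar> \<le> B"
      if "\<And>x. \<bar>k x\<bar> \<le> B" "integrable P (\<lambda>y. k (x(i := y)))" for k :: "('i \<Rightarrow> real) \<Rightarrow> real"
    proof -
      have "\<bar>LINT y|P. k (x(i := y))\<bar> \<le> (LINT y|P. \<bar>k (x(i := y))\<bar>)"
        by (rule integral_abs_bound)
      also have "\<dots> \<le> (LINT y|P. B)"
        using that by (intro integral_mono) auto
      finally show ?thesis by (simp add: P.prob_space)
    qed
    show "\<bar>F x\<bar> \<le> B" "\<bar>G x\<bar> \<le> B"
      unfolding F_def G_def by (intro bound insert.prems f g)+
  qed
  have F [measurable]: "F \<in> borel_measurable (Pi\<^sub>M I (\<lambda>_. P))"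
    and G [measurable]: "G \<in> borel_measurable (Pi\<^sub>M I (\<lambda>_. P))"
    unfolding F_def[abs_def] G_def[abs_def] by (intro lift meas)+
  have "(LINT x|Pi\<^sub>M I (\<lambda>_. P). F x) * (LINT x|Pi\<^sub>M I (\<lambda>_. P). G x)
      \<le> (LINT x|Pi\<^sub>M I (\<lambda>_. P). F x * G x)"
  proof (rule insert.IH)
    show "F y \<le> F x" if "\<And>j. j \<in> I \<Longrightarrow> x j \<le> y j" for x y
      unfolding F_def using that by (intro integral_mono f insert.prems(3)) auto
    show "G y \<le> G x" if "\<And>j. j \<in> I \<Longrightarrow> x j \<le> y j" for x y
      unfolding G_def using that by (intro integral_mono g insert.prems(4)) auto
  qed (fact F G FB GB)+
  also have "\<dots> \<le> (LINT x|Pi\<^sub>M I (\<lambda>_. P). LINT y|P. f (x(i := y)) * g (x(i := y)))"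
  proof (intro integral_mono)
    have "\<bar>F x * G x\<bar> \<le> B2" for x
      using mult_mono[OF FB[of x] GB[of x]] FB[of x] by (auto simp: abs_mult B2_def)
    then show "integrable (Pi\<^sub>M I (\<lambda>_. P)) (\<lambda>x. F x * G x)"
      by (intro I.integrable_const_bound[where B=B2]) auto
    have "\<bar>LINT y|P. f (x(i := y)) * g (x(i := y))\<bar> \<le> B2" for x
    proof -
      have "\<bar>LINT y|P. f (x(i := y)) * g (x(i := y))\<bar> \<le> (LINT y|P. \<bar>f (x(i := y)) * g (x(i := y))\<bar>)"
        by (rule integral_abs_bound)
      also have "\<dots> \<le> (LINT y|P. B2)"
        using fg fgB by (intro integral_mono) auto
      finally show ?thesis by (simp add: P.prob_space)
    qed
    then show "integrable (Pi\<^sub>M I (\<lambda>_. P)) (\<lambda>x. LINT y|P. f (x(i := y)) * g (x(i := y)))"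
      by (intro I.integrable_const_bound[where B=B2] lift) auto
    show "F x * G x \<le> (LINT y|P. f (x(i := y)) * g (x(i := y)))" for x
      unfolding F_def G_def
      by (intro Chebyshev_integral_antimono f g fg P)
        (auto simp: antimono_def intro!: insert.prems(3,4))
  qed
  also have "\<dots> = (LINT x|Pi\<^sub>M (insert i I) (\<lambda>_. P). f x * g x)"
    using insert.hyps fgB
    by (intro product_integral_insert[symmetric] J.integrable_const_bound[where B=B2]) auto
  also have "(LINT x|Pi\<^sub>M I (\<lambda>_. P). F x) = (LINT x|Pi\<^sub>M (insert i I) (\<lambda>_. P). f x)"
    unfolding F_def using insert.hyps insert.prems(5)
    by (intro product_integral_insert[symmetric] J.integrable_const_bound[where B=B]) auto
  also have "(LINT x|Pi\<^sub>M I (\<lambda>_. P). G x) = (LINT x|Pi\<^sub>M (insert i I) (\<lambda>_. P). g x)"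
    unfolding G_def using insert.hyps insert.prems(6)
    by (intro product_integral_insert[symmetric] J.integrable_const_bound[where B=B]) auto
  finally show ?case .
qed

text \<open>Truncating \<open>g\<close> at \<open>- n\<close> and \<open>n\<close> keeps it
  antitone; dominated convergence removes the truncation, as \<open>f\<close> is bounded and
  \<open>g\<close> integrable.\<close>

lemma Harris:
  fixes f g :: "('i \<Rightarrow> real) \<Rightarrow> real"
  assumes P: "prob_space P" "sets P = sets borel" and "finite I"
    and f [measurable]: "f \<in> borel_measurable (Pi\<^sub>M I (\<lambda>_. P))"
    and g: "integrable (Pi\<^sub>M I (\<lambda>_. P)) g"
    and f_anti: "\<And>x y. (\<And>i. i \<in> I \<Longrightarrow> x i \<le> y i) \<Longrightarrow> f y \<le> f x"
    and g_anti: "\<And>x y. (\<And>i. i \<in> I \<Longrightarrow> x i \<le> y i) \<Longrightarrow> g y \<le> g x"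
    and fB: "\<And>x. \<bar>f x\<bar> \<le> B"
  shows "(LINT x|Pi\<^sub>M I (\<lambda>_. P). f x) * (LINT x|Pi\<^sub>M I (\<lambda>_. P). g x)
    \<le> (LINT x|Pi\<^sub>M I (\<lambda>_. P). f x * g x)"
proof -
  let ?Q = "Pi\<^sub>M I (\<lambda>_. P)"
  define G where "G n x = max (- real n) (min (real n) (g x))" for n x
  note [measurable] = borel_measurable_integrable[OF g]
  have G [measurable]: "G n \<in> borel_measurable ?Q" for n unfolding G_def[abs_def] by measurable
  have Gg: "\<bar>G n x\<bar> \<le> \<bar>g x\<bar>" for n x by (auto simp: G_def)
  have lim: "(\<lambda>n. G n x) \<longlonglongrightarrow> g x" for x
  proof -
    obtain m where "\<bar>g x\<bar> \<le> real m" using real_arch_simple by blast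
    then have "\<forall>\<^sub>F n in sequentially. G n x = g x"
      by (intro eventually_sequentiallyI[of m]) (auto simp: G_def)
    then show ?thesis by (rule tendsto_eventually)
  qed
  have fGg: "\<bar>f x * G n x\<bar> \<le> B * \<bar>g x\<bar>" for n x
    using mult_mono[OF fB[of x] Gg[of n x]] fB[of x] by (simp add: abs_mult)
  have "(LINT x|?Q. f x) * (LINT x|?Q. G n x) \<le> (LINT x|?Q. f x * G n x)" for n
  proof (rule Harris_bounded[OF P assms(3) f G])
    show "\<bar>f x\<bar> \<le> max B (real n)" for x using fB[of x] by auto
    show "\<bar>G n x\<bar> \<le> max B (real n)" for x by (auto simp: G_def)
    show "G n y \<le> G n x" if "\<And>i. i \<in> I \<Longrightarrow> x i \<le> y i" for x y
    proof -
      have "g y \<le> g x" using that by (rule g_anti)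
      then show ?thesis by (auto simp: G_def)
    qed
  qed (fact f_anti)
  moreover have "(\<lambda>n. LINT x|?Q. G n x) \<longlonglongrightarrow> (LINT x|?Q. g x)"
    using g Gg lim by (intro integral_dominated_convergence[where w="\<lambda>x. \<bar>g x\<bar>"]) auto
  moreover have "(\<lambda>n. LINT x|?Q. f x * G n x) \<longlonglongrightarrow> (LINT x|?Q. f x * g x)"
    using g fGg lim
    by (intro integral_dominated_convergence[where w="\<lambda>x. B * \<bar>g x\<bar>"]) (auto intro!: tendsto_mult)
  ultimately show ?thesis
    by (intro LIMSEQ_le[OF tendsto_mult[OF tendsto_const]]) auto
qed

section \<open>The newsvendor problem\<close>

definition newsvendor_cost :: "'a measure \<Rightarrow> ('a \<Rightarrow> real) \<Rightarrow> real \<Rightarrow> real \<Rightarrow> real \<Rightarrow> real" where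
  "newsvendor_cost M X h p S = (LINT \<omega>|M. h * max 0 (S - X \<omega>) + p * max 0 (X \<omega> - S))"

definition newsvendor_quantile :: "'a measure \<Rightarrow> ('a \<Rightarrow> real) \<Rightarrow> real \<Rightarrow> real \<Rightarrow> real" where
  "newsvendor_quantile M X h p = Inf {S. p / (p + h) \<le> measure M {\<omega>\<in>space M. X \<omega> \<le> S}}"

locale newsvendor = prob_space M for M :: "'a measure" +
  fixes X :: "'a \<Rightarrow> real" and h :: real
  assumes X_integrable: "integrable M X" and X_nonneg: "AE \<omega> in M. 0 \<le> X \<omega>" and h_pos: "0 < h"
begin

abbreviation cost :: "real \<Rightarrow> real \<Rightarrow> real" where
  "cost \<equiv> newsvendor_cost M X h"

abbreviation quantile :: "real \<Rightarrow> real" where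
  "quantile \<equiv> newsvendor_quantile M X h"

lemma X_measurable [measurable]: "X \<in> borel_measurable M"
  using X_integrable by auto

lemma cost_integrable: "integrable M (\<lambda>\<omega>. a * max 0 (S - X \<omega>) + p * max 0 (X \<omega> - S))"
  using X_integrable by auto

section \<open>The critical quantile as a minimiser\<close>

lemma prob_mono: "S \<le> S' \<Longrightarrow> prob {\<omega>\<in>space M. X \<omega> \<le> S} \<le> prob {\<omega>\<in>space M. X \<omega> \<le> S'}"
  by (intro finite_measure_mono) auto

lemma cdf_distr: "cdf (distr M borel X) S = prob {\<omega>\<in>space M. X \<omega> \<le> S}"
  unfolding cdf_def by (subst measure_distr) (auto intro!: arg_cong[where f=prob])

text \<open>Together these make the \<open>Inf\<close> in \<open>newsvendor_quantile\<close> a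
  genuine infimum: the distribution function tends to 1, above the critical ratio, and vanishes to
  the left of 0.\<close>

lemma quantile_set:
  assumes "0 < p"
  shows "{S. p / (p + h) \<le> prob {\<omega>\<in>space M. X \<omega> \<le> S}} \<noteq> {}"
    and "p / (p + h) \<le> prob {\<omega>\<in>space M. X \<omega> \<le> S} \<Longrightarrow> 0 \<le> S"
proof -
  interpret X: real_distribution "distr M borel X" by (rule real_distribution_distr) simp
  have "p / (p + h) < 1" using assms h_pos by simp
  from order_tendstoD(1)[OF X.cdf_lim_at_top_prob this]
  obtain S where "p / (p + h) < prob {\<omega>\<in>space M. X \<omega> \<le> S}"
    unfolding cdf_distr eventually_at_top_linorder by blast
  then show "{S. p / (p + h) \<le> prob {\<omega>\<in>space M. X \<omega> \<le> S}} \<noteq> {}" by (auto intro: less_imp_le)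
next
  assume S: "p / (p + h) \<le> prob {\<omega>\<in>space M. X \<omega> \<le> S}"
  show "0 \<le> S"
  proof (rule ccontr)
    assume "\<not> 0 \<le> S"
    then have "AE \<omega> in M. \<not> X \<omega> \<le> S" using X_nonneg by auto
    then have "prob {\<omega>\<in>space M. X \<omega> \<le> S} = 0" by (subst prob_eq_0) auto
    moreover have "0 < p / (p + h)" using assms h_pos by simp
    ultimately show False using S by simp
  qed
qed

lemma bdd_below_quantile_set:
  "0 < p \<Longrightarrow> bdd_below {S. p / (p + h) \<le> prob {\<omega>\<in>space M. X \<omega> \<le> S}}"
  using quantile_set(2) by (auto intro!: bdd_belowI[of _ 0])

lemma below_quantile:
  assumes "0 < p" "S < quantile p"
  shows "prob {\<omega>\<in>space M. X \<omega> \<le> S} < p / (p + h)"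
proof (rule ccontr)
  assume "\<not> ?thesis"
  then have "quantile p \<le> S"
    unfolding newsvendor_quantile_def by (intro cInf_lower bdd_below_quantile_set assms) auto
  with assms(2) show False by simp
qed

lemma above_quantile:
  assumes "0 < p" "quantile p < S"
  shows "p / (p + h) \<le> prob {\<omega>\<in>space M. X \<omega> \<le> S}"
proof -
  obtain S' where "p / (p + h) \<le> prob {\<omega>\<in>space M. X \<omega> \<le> S'}" "S' < S"
    using assms(2) quantile_set(1)[OF assms(1)]
    unfolding newsvendor_quantile_def by (subst (asm) cInf_less_iff) (auto intro: bdd_below_quantile_set assms)
  with prob_mono[of S' S] show ?thesis by simp
qed

text \<open>The infimum is attained because distribution functions are right-continuous.\<close>

lemma at_quantile:
  assumes "0 < p"
  shows "p / (p + h) \<le> prob {\<omega>\<in>space M. X \<omega> \<le> quantile p}"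
proof -
  interpret X: real_distribution "distr M borel X" by (rule real_distribution_distr) simp
  have "((\<lambda>S. prob {\<omega>\<in>space M. X \<omega> \<le> S}) \<longlongrightarrow> prob {\<omega>\<in>space M. X \<omega> \<le> quantile p}) (at_right (quantile p))"
    using X.cdf_is_right_cont[of "quantile p"] by (simp add: cdf_distr[abs_def] continuous_within)
  then show ?thesis
    by (rule tendsto_lowerbound)
      (use above_quantile[OF assms] in \<open>auto simp: eventually_at_right_field intro: gt_ex\<close>)
qed

text \<open>The slope \<open>h * P(X \<le> S) - p * P(X > S)\<close> is a subgradient of the cost at \<open>S\<close>.\<close>

lemma cost_subgradient:
  assumes "0 < p"
  shows "cost p S + ((p + h) * prob {\<omega>\<in>space M. X \<omega> \<le> S} - p) * (S' - S) \<le> cost p S'"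
proof -
  let ?I = "indicator {\<omega>\<in>space M. X \<omega> \<le> S} :: 'a \<Rightarrow> real"
  have I: "integrable M ?I" by (simp add: less_top[symmetric])
  let ?c = "\<lambda>S \<omega>. h * max 0 (S - X \<omega>) + p * max 0 (X \<omega> - S)"
  have "cost p S + ((p + h) * prob {\<omega>\<in>space M. X \<omega> \<le> S} - p) * (S' - S)
      = (LINT \<omega>|M. ?c S \<omega> + ((p + h) * ?I \<omega> - p) * (S' - S))"
    unfolding newsvendor_cost_def using cost_integrable[of h S p] I
    by (subst Bochner_Integration.integral_add) (auto simp: prob_space less_top[symmetric])
  also have "\<dots> \<le> (LINT \<omega>|M. ?c S' \<omega>)"
  proof (rule integral_mono)
    show "integrable M (\<lambda>\<omega>. ?c S \<omega> + ((p + h) * ?I \<omega> - p) * (S' - S))"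
      using cost_integrable[of h S p] I by auto
    fix \<omega> assume "\<omega> \<in> space M"
    show "?c S \<omega> + ((p + h) * ?I \<omega> - p) * (S' - S) \<le> ?c S' \<omega>"
    proof (cases "X \<omega> \<le> S")
      case True
      then have "?c S \<omega> + ((p + h) * ?I \<omega> - p) * (S' - S) = h * (S' - X \<omega>)"
        using \<open>\<omega> \<in> space M\<close> by (simp add: algebra_simps)
      also have "\<dots> \<le> h * max 0 (S' - X \<omega>)" using h_pos by (intro mult_left_mono) auto
      also have "\<dots> \<le> ?c S' \<omega>" using assms by simp
      finally show ?thesis .
    next
      case False
      then have "?c S \<omega> + ((p + h) * ?I \<omega> - p) * (S' - S) = p * (X \<omega> - S')"
        by (simp add: algebra_simps)
      also have "\<dots> \<le> p * max 0 (X \<omega> - S')" using assms by (intro mult_left_mono) auto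
      also have "\<dots> \<le> ?c S' \<omega>" using h_pos by simp
      finally show ?thesis .
    qed
  qed (rule cost_integrable)
  finally show ?thesis by (simp add: newsvendor_cost_def)
qed

text \<open>Raising the level adds at most \<open>h\<close> per unit in holding cost and never adds
  shortage.\<close>

lemma cost_Lipschitz:
  assumes "0 < p" "S \<le> S'"
  shows "cost p S' \<le> cost p S + h * (S' - S)"
proof -
  have "cost p S' \<le> (LINT \<omega>|M. (h * max 0 (S - X \<omega>) + p * max 0 (X \<omega> - S)) + h * (S' - S))"
    unfolding newsvendor_cost_def
  proof (rule integral_mono)
    fix \<omega>
    have "h * max 0 (S' - X \<omega>) \<le> h * (max 0 (S - X \<omega>) + (S' - S))"
      using assms h_pos by (intro mult_left_mono) auto
    moreover have "p * max 0 (X \<omega> - S') \<le> p * max 0 (X \<omega> - S)"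
      using assms by (intro mult_left_mono) auto
    ultimately show "h * max 0 (S' - X \<omega>) + p * max 0 (X \<omega> - S')
        \<le> (h * max 0 (S - X \<omega>) + p * max 0 (X \<omega> - S)) + h * (S' - S)"
      by (simp add: algebra_simps)
  qed (use X_integrable in auto)
  also have "\<dots> = cost p S + h * (S' - S)"
    unfolding newsvendor_cost_def using cost_integrable[of h S p]
    by (subst Bochner_Integration.integral_add) (auto simp: prob_space)
  finally show ?thesis .
qed

text \<open>The slope of \<open>cost_subgradient\<close> is nonnegative at the quantile and at most
  0 below it. Levels below the quantile are compared with a level \<open>S'\<close> just under it,
  and \<open>cost_Lipschitz\<close> bridges the remaining gap.\<close>

lemma quantile_optimal:
  assumes "0 < p"
  shows "cost p (quantile p) \<le> cost p S"
proof (cases "quantile p \<le> S")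
  case True
  have "p \<le> (p + h) * prob {\<omega>\<in>space M. X \<omega> \<le> quantile p}"
    using at_quantile[OF assms] assms h_pos by (simp add: field_simps)
  then have "0 \<le> ((p + h) * prob {\<omega>\<in>space M. X \<omega> \<le> quantile p} - p) * (S - quantile p)"
    using True by simp
  with cost_subgradient[OF assms, of "quantile p" S] show ?thesis by simp
next
  case False
  show ?thesis
  proof (rule field_le_epsilon)
    fix e :: real assume "0 < e"
    \<comment> \<open>The midpoint keeps \<open>S'\<close> between \<open>S\<close> and the
      quantile; the other term brings it within \<open>e / h\<close> of the quantile, so the
      Lipschitz bound costs at most \<open>e\<close>.\<close>
    define S' where "S' = max ((S + quantile p) / 2) (quantile p - e / h)"
    have S': "S \<le> S'" "S' < quantile p" "h * (quantile p - S') \<le> e"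
      using False \<open>0 < e\<close> h_pos by (auto simp: S'_def max_def field_simps)
    have "(p + h) * prob {\<omega>\<in>space M. X \<omega> \<le> S'} \<le> p"
      using below_quantile[OF assms S'(2)] assms h_pos by (simp add: field_simps)
    then have "0 \<le> ((p + h) * prob {\<omega>\<in>space M. X \<omega> \<le> S'} - p) * (S - S')"
      using S' by (intro mult_nonpos_nonpos) auto
    with cost_subgradient[OF assms, of S' S] have "cost p S' \<le> cost p S" by simp
    with cost_Lipschitz[OF assms, of S' "quantile p"] S' show "cost p (quantile p) \<le> cost p S + e" by simp
  qed
qed


section \<open>Growth of the optimal cost with the penalty\<close>

lemma quantile_eventually_ge:
  assumes "prob {\<omega>\<in>space M. X \<omega> \<le> s} < 1"
  shows "\<forall>\<^sub>F p in at_top. s \<le> quantile p"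
proof -
  let ?a = "prob {\<omega>\<in>space M. X \<omega> \<le> s}"
  \<comment> \<open>The threshold \<open>?a * h / (1 - ?a)\<close> is the solution of
    \<open>p / (p + h) = ?a\<close>.\<close>
  have "\<forall>\<^sub>F p in at_top. max 0 (?a * h / (1 - ?a)) < p" by (rule eventually_gt_at_top)
  then show ?thesis
  proof eventually_elim
    case (elim p)
    then have "0 < p" by simp
    moreover from this have "?a < p / (p + h)"
      using elim assms h_pos by (simp add: field_simps)
    ultimately show ?case using above_quantile[of p s] by force
  qed
qed

lemma cost_nonneg: "0 \<le> p \<Longrightarrow> 0 \<le> cost p S"
  unfolding newsvendor_cost_def using h_pos by (intro integral_nonneg_AE AE_I2) simp

lemma optimal_cost_mono:
  assumes "0 < p" "p \<le> p'"
  shows "cost p (quantile p) \<le> cost p' (quantile p')"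
proof -
  have "cost p (quantile p) \<le> cost p (quantile p')" by (rule quantile_optimal[OF assms(1)])
  also have "\<dots> \<le> cost p' (quantile p')"
    unfolding newsvendor_cost_def using assms
    by (intro integral_mono cost_integrable add_left_mono mult_right_mono) auto
  finally show ?thesis .
qed

lemma cost_ge_holding: "0 \<le> p \<Longrightarrow> h * (S - expectation X) \<le> cost p S"
proof -
  assume "0 \<le> p"
  have "h * (S - expectation X) = (LINT \<omega>|M. h * (S - X \<omega>))"
    using X_integrable by (simp add: prob_space)
  also have "\<dots> \<le> cost p S"
    unfolding newsvendor_cost_def
  proof (rule integral_mono)
    fix \<omega>
    have "h * (S - X \<omega>) \<le> h * max 0 (S - X \<omega>)" using h_pos by (intro mult_left_mono) auto
    also have "\<dots> \<le> h * max 0 (S - X \<omega>) + p * max 0 (X \<omega> - S)" using \<open>0 \<le> p\<close> by simp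
    finally show "h * (S - X \<omega>) \<le> h * max 0 (S - X \<omega>) + p * max 0 (X \<omega> - S)" .
  qed (use X_integrable in auto)
  finally show ?thesis .
qed

text \<open>The shortage vanishes off the event \<open>X > S\<close>, and \<open>mean_excess\<close>
  is its average over that event, which has positive probability.\<close>

lemma expected_shortage:
  assumes "prob {\<omega>\<in>space M. X \<omega> \<le> S} < 1"
  shows "(LINT \<omega>|M. max 0 (X \<omega> - S)) = mean_excess M X S * (1 - prob {\<omega>\<in>space M. X \<omega> \<le> S})"
proof -
  let ?A = "{\<omega>\<in>space M. S < X \<omega>}"
  have "?A = space M - {\<omega>\<in>space M. X \<omega> \<le> S}" by auto
  then have A: "prob ?A = 1 - prob {\<omega>\<in>space M. X \<omega> \<le> S}" by (simp add: prob_compl)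
  with assms have pos: "0 < prob ?A" by simp
  have "uniform_measure M ?A = density M (\<lambda>\<omega>. ennreal (indicator ?A \<omega> / prob ?A))"
    unfolding uniform_measure_def using pos
    by (intro density_cong) (auto simp: emeasure_eq_measure divide_ennreal[symmetric] indicator_def)
  then have "mean_excess M X S = (LINT \<omega>|M. (indicator ?A \<omega> / prob ?A) *\<^sub>R (X \<omega> - S))"
    unfolding mean_excess_def by (simp add: integral_density)
  also have "\<dots> = (LINT \<omega>|M. max 0 (X \<omega> - S) / prob ?A)"
    by (intro Bochner_Integration.integral_cong) (auto simp: indicator_def)
  also have "\<dots> = (LINT \<omega>|M. max 0 (X \<omega> - S)) / prob ?A" by simp
  finally show ?thesis using pos by (simp add: A)
qed

lemma mean_excess_nonneg: "0 \<le> mean_excess M X S"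
  unfolding mean_excess_def
proof (rule integral_nonneg_AE)
  show "AE \<omega> in uniform_measure M {\<omega>\<in>space M. S < X \<omega>}. 0 \<le> X \<omega> - S"
    by (rule AE_uniform_measureI) auto
qed

text \<open>Keep the level that is optimal for \<open>p\<close> when the penalty rises to
  \<open>k * p\<close>. The extra cost is \<open>(k - 1) * p\<close> times the expected shortage,
  and at the quantile \<open>p\<close> times the probability of a shortage is at most
  \<open>h\<close>.\<close>

lemma optimal_cost_scale:
  assumes "0 < p" "1 \<le> k" "prob {\<omega>\<in>space M. X \<omega> \<le> quantile p} < 1"
  shows "cost (k * p) (quantile (k * p)) \<le> cost p (quantile p) + (k - 1) * h * mean_excess M X (quantile p)"
proof -
  let ?S = "quantile p"
  have "cost (k * p) (quantile (k * p)) \<le> cost (k * p) ?S"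
    using assms by (intro quantile_optimal) auto
  also have "\<dots> = (LINT \<omega>|M. (h * max 0 (?S - X \<omega>) + p * max 0 (X \<omega> - ?S)) + (k - 1) * p * max 0 (X \<omega> - ?S))"
    unfolding newsvendor_cost_def by (simp add: algebra_simps)
  also have "\<dots> = cost p ?S + (k - 1) * p * (LINT \<omega>|M. max 0 (X \<omega> - ?S))"
    unfolding newsvendor_cost_def using X_integrable
    by (subst Bochner_Integration.integral_add[OF cost_integrable]) auto
  also have "(k - 1) * p * (LINT \<omega>|M. max 0 (X \<omega> - ?S))
      = (k - 1) * mean_excess M X ?S * (p * (1 - prob {\<omega>\<in>space M. X \<omega> \<le> ?S}))"
    by (simp add: expected_shortage[OF assms(3)])
  also have "\<dots> \<le> (k - 1) * mean_excess M X ?S * h"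
  proof (intro mult_left_mono mult_nonneg_nonneg mean_excess_nonneg)
    have "p * (1 - prob {\<omega>\<in>space M. X \<omega> \<le> ?S}) \<le> p * (1 - p / (p + h))"
      using at_quantile[OF assms(1)] assms(1) by (intro mult_left_mono) auto
    also have "\<dots> = h * (p / (p + h))" using assms(1) h_pos by (simp add: field_simps)
    also have "\<dots> \<le> h * 1" using assms(1) h_pos by (intro mult_left_mono) auto
    finally show "p * (1 - prob {\<omega>\<in>space M. X \<omega> \<le> ?S}) \<le> h" by simp
  qed (use assms(2) in simp)
  finally show ?thesis by (simp add: algebra_simps)
qed

text \<open>Stocking the essential bound \<open>B\<close> avoids every shortage, so \<open>G\<close>
  is at most \<open>h * B\<close> for all penalties and increases to its supremum \<open>L\<close>.
  Positivity at \<open>p0\<close> makes \<open>L\<close> a nonzero limit of numerator and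
  denominator alike.\<close>

lemma optimal_cost_ratio_tendsto_bounded:
  assumes "ess_bounded M X" "0 < k" "0 < p0" "0 < cost p0 (quantile p0)"
  shows "((\<lambda>p. cost (k * p) (quantile (k * p)) / cost p (quantile p)) \<longlongrightarrow> 1) at_top"
proof -
  define G where "G p = cost p (quantile p)" for p
  obtain B where "AE \<omega> in M. \<bar>X \<omega>\<bar> \<le> B" using assms(1) by (auto simp: ess_bounded_def)
  then have B: "AE \<omega> in M. 0 \<le> X \<omega> \<and> X \<omega> \<le> B" using X_nonneg by eventually_elim auto
  have GB: "G p \<le> h * B" if "0 < p" for p
  proof -
    have "G p \<le> cost p B" unfolding G_def by (rule quantile_optimal[OF that])
    also have "\<dots> \<le> (LINT \<omega>|M. h * B)"
      unfolding newsvendor_cost_def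
    proof (intro integral_mono_AE cost_integrable)
      show "AE \<omega> in M. h * max 0 (B - X \<omega>) + p * max 0 (X \<omega> - B) \<le> h * B"
        using B
      proof eventually_elim
        case (elim \<omega>)
        then have "h * max 0 (B - X \<omega>) \<le> h * B" using h_pos by (intro mult_left_mono) auto
        with elim show ?case by simp
      qed
    qed simp
    finally show ?thesis by (simp add: prob_space)
  qed
  have mono: "G p \<le> G p'" if "0 < p" "p \<le> p'" for p p'
    unfolding G_def by (rule optimal_cost_mono[OF that])
  define L where "L = (SUP p\<in>{0<..}. G p)"
  have bdd: "bdd_above (G ` {0<..})" using GB by (auto intro!: bdd_aboveI)
  have GL: "G p \<le> L" if "0 < p" for p
    unfolding L_def using that by (intro cSUP_upper bdd) auto
  have "(G \<longlongrightarrow> L) at_top"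
  proof (rule order_tendstoI)
    fix a assume "a < L"
    then obtain p where p: "0 < p" "a < G p"
      unfolding L_def by (subst (asm) less_cSUP_iff[OF _ bdd]) auto
    show "\<forall>\<^sub>F x in at_top. a < G x"
      using eventually_ge_at_top[of p] by eventually_elim (use p mono[of p] in force)
  next
    fix a assume "L < a"
    show "\<forall>\<^sub>F x in at_top. G x < a"
      using eventually_gt_at_top[of 0] by eventually_elim (use GL \<open>L < a\<close> in force)
  qed
  moreover have "filterlim (\<lambda>p. k * p) at_top at_top"
    using assms(2) by (intro filterlim_tendsto_pos_mult_at_top[OF tendsto_const] filterlim_ident)
  ultimately have "((\<lambda>p. G (k * p)) \<longlongrightarrow> L) at_top" by (rule filterlim_compose)
  moreover have "0 < L" using GL[OF assms(3)] assms(4) by (simp add: G_def)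
  ultimately have "((\<lambda>p. G (k * p) / G p) \<longlongrightarrow> L / L) at_top"
    using \<open>(G \<longlongrightarrow> L) at_top\<close> by (intro tendsto_divide) auto
  with \<open>0 < L\<close> show ?thesis by (simp add: G_def)
qed

lemma optimal_cost_ratio_tendsto_unbounded:
  assumes "\<not> ess_bounded M X" "((\<lambda>x. mean_excess M X x / x) \<longlongrightarrow> 0) at_top" "1 \<le> k"
  shows "((\<lambda>p. cost (k * p) (quantile (k * p)) / cost p (quantile p)) \<longlongrightarrow> 1) at_top"
proof -
  let ?\<mu> = "expectation X"
  have lt1: "prob {\<omega>\<in>space M. X \<omega> \<le> s} < 1" for s
  proof (rule ccontr)
    assume "\<not> ?thesis"
    then have "prob {\<omega>\<in>space M. X \<omega> \<le> s} = 1" using prob_le_1 by (simp add: order_antisym not_less)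
    then have "AE \<omega> in M. X \<omega> \<le> s" by (subst (asm) prob_Collect_eq_1) auto
    with X_nonneg have "AE \<omega> in M. \<bar>X \<omega>\<bar> \<le> s" by eventually_elim auto
    with assms(1) show False by (auto simp: ess_bounded_def)
  qed
  have quantile: "filterlim quantile at_top at_top"
    unfolding filterlim_at_top using quantile_eventually_ge[OF lt1] by blast
  have "((\<lambda>p. 1 + 2 * (k - 1) * (mean_excess M X (quantile p) / quantile p)) \<longlongrightarrow> 1 + 2 * (k - 1) * 0) at_top"
    by (intro tendsto_intros filterlim_compose[OF assms(2) quantile])
  then have upper: "((\<lambda>p. 1 + 2 * (k - 1) * (mean_excess M X (quantile p) / quantile p)) \<longlongrightarrow> 1) at_top"
    by simp
  \<comment> \<open>A level \<open>S\<close> of this size satisfies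
    \<open>S - ?\<mu> \<ge> S / 2\<close>, the source of the factor 2 above; the summand 1 makes it
    positive.\<close>
  have "\<forall>\<^sub>F p in at_top. 2 * \<bar>?\<mu>\<bar> + 1 \<le> quantile p" by (rule quantile_eventually_ge[OF lt1])
  with eventually_gt_at_top[of 0]
  have ev: "\<forall>\<^sub>F p in at_top. 1 \<le> cost (k * p) (quantile (k * p)) / cost p (quantile p) \<and>
     cost (k * p) (quantile (k * p)) / cost p (quantile p)
       \<le> 1 + 2 * (k - 1) * (mean_excess M X (quantile p) / quantile p)"
  proof eventually_elim
    case (elim p)
    let ?S = "quantile p" and ?m = "mean_excess M X (quantile p)"
    have "h * (?S / 2) \<le> h * (?S - ?\<mu>)" using elim h_pos by (intro mult_left_mono) auto
    with cost_ge_holding[of p ?S] elim have G: "h * (?S / 2) \<le> cost p ?S" by simp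
    have "0 < h * (?S / 2)" using elim h_pos by simp
    with G have G_pos: "0 < cost p ?S" by simp
    have "cost p ?S \<le> cost (k * p) (quantile (k * p))"
      using elim assms(3) by (intro optimal_cost_mono) auto
    moreover have "cost (k * p) (quantile (k * p)) \<le> cost p ?S + (k - 1) * h * ?m"
      using optimal_cost_scale[OF elim(1) assms(3) lt1] .
    ultimately have "1 \<le> cost (k * p) (quantile (k * p)) / cost p ?S"
      and "cost (k * p) (quantile (k * p)) / cost p ?S \<le> (cost p ?S + (k - 1) * h * ?m) / cost p ?S"
      using G_pos by (auto intro!: divide_right_mono)
    moreover have "(cost p ?S + (k - 1) * h * ?m) / cost p ?S = 1 + (k - 1) * h * ?m / cost p ?S"
      using G_pos by (simp add: add_divide_distrib)
    moreover have "(k - 1) * h * ?m / cost p ?S \<le> (k - 1) * h * ?m / (h * (?S / 2))"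
      using G G_pos elim assms(3) h_pos mean_excess_nonneg
      by (intro divide_left_mono mult_nonneg_nonneg mult_pos_pos) auto
    moreover have "(k - 1) * h * ?m / (h * (?S / 2)) = 2 * (k - 1) * (?m / ?S)"
      using h_pos by simp
    ultimately show ?case by simp
  qed
  show ?thesis
    by (rule tendsto_sandwich[OF _ _ tendsto_const upper])
      (use ev in \<open>auto elim: eventually_mono\<close>)
qed

end

section \<open>Independent and identically distributed demand\<close>

locale iid_demand = prob_space M for M :: "'a measure" +
  fixes D :: "nat \<Rightarrow> 'a \<Rightarrow> real" and \<tau> :: nat
  assumes indep: "indep_vars (\<lambda>_. borel) D UNIV"
    and ident: "\<And>t. distr M borel (D t) = distr M borel (D 0)"
    and D_nonneg: "\<And>t. AE \<omega> in M. 0 \<le> D t \<omega>"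
    and D_integrable: "\<And>t. integrable M (D t)"
begin

definition mean_demand :: real where "mean_demand = (LINT \<omega>|M. D 0 \<omega>)"

section \<open>The law of a window of demands\<close>

definition demand_law :: "(nat \<Rightarrow> real) measure" where
  "demand_law = Pi\<^sub>M {..\<tau>} (\<lambda>_. distr M borel (D 0))"

lemma D_measurable [measurable]: "D t \<in> borel_measurable M"
  using indep by (auto simp: indep_vars_def)

lemma D_nonneg_all: "AE \<omega> in M. \<forall>t. 0 \<le> D t \<omega>"
  using D_nonneg by (simp add: AE_all_countable)

lemma prob_space_single: "prob_space (distr M borel (D 0))"
  by (rule prob_space_distr) simp

lemma prob_space_demand_law: "prob_space demand_law"
  unfolding demand_law_def by (intro prob_space_PiM prob_space_single)

lemma sets_demand_law: "sets demand_law = sets (Pi\<^sub>M {..\<tau>} (\<lambda>_. borel))"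
  unfolding demand_law_def by (intro sets_PiM_cong) auto

lemma window_measurable [measurable]:
  "(\<lambda>\<omega>. \<lambda>i\<in>{..\<tau>}. D (t + i) \<omega>) \<in> M \<rightarrow>\<^sub>M Pi\<^sub>M {..\<tau>} (\<lambda>_. borel)"
  by (intro measurable_restrict) simp

text \<open>The whole demand sequence has a product law with equal factors, and its image under
  reindexing by the injection \<open>(+) t\<close> is again such a product.\<close>

lemma distr_window:
  "distr M (Pi\<^sub>M {..\<tau>} (\<lambda>_. borel)) (\<lambda>\<omega>. \<lambda>i\<in>{..\<tau>}. D (t + i) \<omega>) = demand_law"
proof -
  let ?P = "distr M borel (D 0)"
  have "(\<lambda>i. distr M borel (D i)) = (\<lambda>_. ?P)"
    by (intro ext ident)
  moreover have "distr M (\<Pi>\<^sub>M i\<in>UNIV. borel) (\<lambda>\<omega>. \<lambda>i\<in>UNIV. D i \<omega>) = (\<Pi>\<^sub>M i\<in>UNIV. distr M borel (D i))"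
    using indep by (subst (asm) indep_vars_iff_distr_eq_PiM) auto
  ultimately have all: "distr M (\<Pi>\<^sub>M i\<in>UNIV. borel) (\<lambda>\<omega>. \<lambda>i\<in>UNIV. D i \<omega>) = (\<Pi>\<^sub>M i\<in>UNIV. ?P)"
    by simp
  have m1: "(\<lambda>x. \<lambda>i\<in>{..\<tau>}. x (t + i)) \<in> (\<Pi>\<^sub>M i\<in>UNIV. borel) \<rightarrow>\<^sub>M Pi\<^sub>M {..\<tau>} (\<lambda>_. borel :: real measure)"
    by (intro measurable_restrict measurable_component_singleton) auto
  have m2: "(\<lambda>\<omega>. \<lambda>i\<in>UNIV. D i \<omega>) \<in> M \<rightarrow>\<^sub>M (\<Pi>\<^sub>M i\<in>UNIV. borel)"
    by (intro measurable_restrict) simp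
  have "demand_law = distr (\<Pi>\<^sub>M i\<in>UNIV. ?P) (Pi\<^sub>M {..\<tau>} (\<lambda>_. ?P)) (\<lambda>x. \<lambda>i\<in>{..\<tau>}. x (t + i))"
    unfolding demand_law_def
    using distr_PiM_reindex[of UNIV "\<lambda>_. ?P" "(+) t" "{..\<tau>}"] prob_space_single by simp
  also have "\<dots> = distr (\<Pi>\<^sub>M i\<in>UNIV. ?P) (Pi\<^sub>M {..\<tau>} (\<lambda>_. borel)) (\<lambda>x. \<lambda>i\<in>{..\<tau>}. x (t + i))"
    by (intro distr_cong sets_PiM_cong) auto
  also have "\<dots> = distr M (Pi\<^sub>M {..\<tau>} (\<lambda>_. borel)) (\<lambda>\<omega>. \<lambda>i\<in>{..\<tau>}. D (t + i) \<omega>)"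
    unfolding all[symmetric] by (subst distr_distr[OF m1 m2]) (simp add: comp_def)
  finally show ?thesis ..
qed

lemma integral_window:
  fixes F :: "(nat \<Rightarrow> real) \<Rightarrow> real"
  assumes "F \<in> borel_measurable (Pi\<^sub>M {..\<tau>} (\<lambda>_. borel))"
  shows "(LINT x|demand_law. F x) = (LINT \<omega>|M. F (\<lambda>i\<in>{..\<tau>}. D (t + i) \<omega>))"
    and "integrable demand_law F \<longleftrightarrow> integrable M (\<lambda>\<omega>. F (\<lambda>i\<in>{..\<tau>}. D (t + i) \<omega>))"
  using assms unfolding distr_window[of t, symmetric]
  by (simp_all add: integral_distr integrable_distr_eq)

text \<open>The condition on \<open>restrict\<close> says that \<open>F\<close> reads only the
  coordinates up to \<open>\<tau>\<close>, so it can be applied to the whole shifted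
  sequence.\<close>

lemma expectation_shift:
  fixes F :: "(nat \<Rightarrow> real) \<Rightarrow> real"
  assumes "F \<in> borel_measurable (Pi\<^sub>M {..\<tau>} (\<lambda>_. borel))" "\<And>x. F (restrict x {..\<tau>}) = F x"
  shows "(LINT \<omega>|M. F (\<lambda>i. D (t + i) \<omega>)) = (LINT \<omega>|M. F (\<lambda>i. D i \<omega>))"
proof -
  have "(LINT \<omega>|M. F (\<lambda>i. D (s + i) \<omega>)) = (LINT x|demand_law. F x)" for s
    using integral_window(1)[OF assms(1), of s] assms(2)[of "\<lambda>i. D (s + i) _"] by simp
  from this[of t] this[of 0] show ?thesis by simp
qed

lemma expectation_D: "(LINT \<omega>|M. D t \<omega>) = mean_demand"
proof -
  have "(LINT \<omega>|M. D t \<omega>) = (LINT x|distr M borel (D t). x)" by (simp add: integral_distr)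
  then show ?thesis unfolding ident[of t] by (simp add: integral_distr mean_demand_def)
qed

text \<open>The nonnegative counterpart of \<open>integral_indep_pair\<close>, for costs under an
  arbitrary policy, which may have infinite mean.\<close>

lemma nn_integral_indep_pair:
  assumes ind: "indep_var S X T Y" and F [measurable]: "F \<in> borel_measurable (S \<Otimes>\<^sub>M T)"
  shows "(\<integral>\<^sup>+\<omega>. F (X \<omega>, Y \<omega>) \<partial>M) = (\<integral>\<^sup>+\<omega>. \<integral>\<^sup>+\<omega>'. F (X \<omega>, Y \<omega>') \<partial>M \<partial>M)"
proof -
  have X [measurable]: "X \<in> M \<rightarrow>\<^sub>M S" and Y [measurable]: "Y \<in> M \<rightarrow>\<^sub>M T"
    and eq: "distr M S X \<Otimes>\<^sub>M distr M T Y = distr M (S \<Otimes>\<^sub>M T) (\<lambda>x. (X x, Y x))"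
    using ind by (auto simp: indep_var_distribution_eq)
  interpret Y: prob_space "distr M T Y" by (rule prob_space_distr) fact
  have "(\<integral>\<^sup>+\<omega>. F (X \<omega>, Y \<omega>) \<partial>M) = (\<integral>\<^sup>+z. F z \<partial>(distr M S X \<Otimes>\<^sub>M distr M T Y))"
    unfolding eq by (simp add: nn_integral_distr)
  also have "\<dots> = (\<integral>\<^sup>+x. \<integral>\<^sup>+y. F (x, y) \<partial>distr M T Y \<partial>distr M S X)"
    by (subst Y.nn_integral_fst[symmetric]) auto
  also have "\<dots> = (\<integral>\<^sup>+\<omega>. \<integral>\<^sup>+y. F (X \<omega>, y) \<partial>distr M T Y \<partial>M)"
    by (subst nn_integral_distr) (auto intro!: Y.borel_measurable_nn_integral)
  also have "\<dots> = (\<integral>\<^sup>+\<omega>. \<integral>\<^sup>+\<omega>'. F (X \<omega>, Y \<omega>') \<partial>M \<partial>M)"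
    using measurable_space[OF X] by (intro nn_integral_cong) (auto simp: nn_integral_distr)
  finally show ?thesis .
qed

section \<open>Pipelines and their independence of later demands\<close>

abbreviation orders :: "policy \<Rightarrow> 'a \<Rightarrow> nat \<Rightarrow> real" where
  "orders A \<omega> \<equiv> order_seq \<tau> A (\<lambda>s. D s \<omega>)"

abbreviation pipe :: "policy \<Rightarrow> 'a \<Rightarrow> nat \<Rightarrow> nat \<Rightarrow> real" where
  "pipe A \<omega> t \<equiv> pipeline (orders A \<omega>) (\<lambda>s. D s \<omega>) t"

lemma orders_nonneg: "A \<in> policies \<tau> \<Longrightarrow> \<omega> \<in> space M \<Longrightarrow> 0 \<le> orders A \<omega> s"
  using order_measurable[of A \<tau> "\<lambda>\<omega> s. D s \<omega>" M s]
  by (auto simp: measurable_restrict_space2_iff)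

lemma orders_measurable:
  "A \<in> policies \<tau> \<Longrightarrow> (\<lambda>\<omega>. orders A \<omega> s) \<in> borel_measurable M"
  using order_measurable[of A \<tau> "\<lambda>\<omega> s. D s \<omega>" M s]
  by (auto simp: measurable_restrict_space2_iff)

text \<open>The orders placed up to period \<open>t\<close> depend only on the demands before period \<open>t\<close>.\<close>

lemma indep_pipe:
  assumes "A \<in> policies \<tau>"
  shows "indep_var (Pi\<^sub>M {..\<tau>} (\<lambda>_. borel)) (\<lambda>\<omega>. restrict (pipe A \<omega> t) {..\<tau>})
    (Pi\<^sub>M {..\<tau>} (\<lambda>_. borel)) (\<lambda>\<omega>. \<lambda>i\<in>{..\<tau>}. D (t + i) \<omega>)"
proof -
  let ?P = "Pi\<^sub>M {..<t} (\<lambda>_. borel) :: (nat \<Rightarrow> real) measure"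
  let ?T = "Pi\<^sub>M {t..t + \<tau>} (\<lambda>_. borel) :: (nat \<Rightarrow> real) measure"
  \<comment> \<open>\<open>E\<close> continues the first \<open>t\<close> demands by 0. Orders
    arriving up to period \<open>t + \<tau>\<close> do not look at later demands, so they are
    unchanged.\<close>
  define E where "E = (\<lambda>(w :: nat \<Rightarrow> real) s. if s < t then w s else 0)"
  define g where "g w = restrict (pipeline (order_seq \<tau> A (E w)) (E w) t) {..\<tau>}" for w
  have E: "(\<lambda>w. E w s) \<in> borel_measurable ?P" for s
    unfolding E_def by (cases "s < t") (auto intro!: measurable_component_singleton)
  have q: "(\<lambda>w. order_seq \<tau> A (E w) s) \<in> borel_measurable ?P" for s
    using order_measurable[OF assms, of E ?P s] E by (auto simp: measurable_restrict_space2_iff)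
  have g: "g \<in> ?P \<rightarrow>\<^sub>M Pi\<^sub>M {..\<tau>} (\<lambda>_. borel)"
    unfolding g_def pipeline_def
  proof (rule measurable_restrict)
    fix i
    show "(\<lambda>w. if i = 0 then inventory (order_seq \<tau> A (E w)) (E w) t
        else order_seq \<tau> A (E w) (t + i)) \<in> borel_measurable ?P"
      using inventory_measurable[OF q E] q by (cases "i = 0") auto
  qed
  have order_eq: "orders A \<omega> s = order_seq \<tau> A (E (restrict (\<lambda>i. D i \<omega>) {..<t})) s"
    if "s \<le> t + \<tau>" for \<omega> s
    using that unfolding E_def by (intro order_cong) auto
  have eq: "restrict (pipe A \<omega> t) {..\<tau>} = g (restrict (\<lambda>i. D i \<omega>) {..<t})" for \<omega>
    unfolding g_def pipeline_def
    by (auto simp: fun_eq_iff order_eq restrict_def intro!: inventory_cong order_eq)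
       (auto simp: E_def)
  have f: "(\<lambda>x. \<lambda>i\<in>{..\<tau>}. x (t + i)) \<in> ?T \<rightarrow>\<^sub>M Pi\<^sub>M {..\<tau>} (\<lambda>_. borel)"
    by (intro measurable_restrict measurable_component_singleton) auto
  have "indep_var ?P (\<lambda>\<omega>. restrict (\<lambda>i. D i \<omega>) {..<t}) ?T (\<lambda>\<omega>. restrict (\<lambda>i. D i \<omega>) {t..t + \<tau>})"
    by (rule indep_var_restrict[OF indep]) auto
  from indep_var_compose[OF this g f]
  have "indep_var (Pi\<^sub>M {..\<tau>} (\<lambda>_. borel)) (\<lambda>\<omega>. g (restrict (\<lambda>i. D i \<omega>) {..<t}))
    (Pi\<^sub>M {..\<tau>} (\<lambda>_. borel)) (\<lambda>\<omega>. \<lambda>i\<in>{..\<tau>}. restrict (\<lambda>i. D i \<omega>) {t..t + \<tau>} (t + i))"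
    by (simp add: comp_def)
  moreover have "(\<lambda>i\<in>{..\<tau>}. restrict (\<lambda>i. D i \<omega>) {t..t + \<tau>} (t + i)) = (\<lambda>i\<in>{..\<tau>}. D (t + i) \<omega>)" for \<omega>
    by auto
  ultimately show ?thesis by (simp add: eq)
qed

section \<open>Comparison with a backorder system over one window\<close>

abbreviation X :: "nat \<Rightarrow> 'a \<Rightarrow> real" where
  "X t \<omega> \<equiv> \<Sum>i\<le>\<tau>. D (t + i) \<omega>"

lemma expectation_X: "(LINT \<omega>|M. X t \<omega>) = real (Suc \<tau>) * mean_demand"
  using D_integrable by (simp add: expectation_D)

lemma inventory_integrable: "integrable M (\<lambda>\<omega>. inventory z (\<lambda>i. D (t + i) \<omega>) k)"
proof (induction k)
  case (Suc k)
  then show ?case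
    unfolding inventory.simps
    by (intro Bochner_Integration.integrable_add integrable_max Bochner_Integration.integrable_diff
        D_integrable integrable_const)
qed simp

lemma demand_component [measurable]:
  "i \<le> \<tau> \<Longrightarrow> (\<lambda>x. x i) \<in> borel_measurable (Pi\<^sub>M {..\<tau>} (\<lambda>_. borel))"
  by (rule measurable_component_singleton) simp

lemma inventory_measurable_window:
  "k \<le> \<tau> \<Longrightarrow> (\<lambda>x. inventory z x k) \<in> borel_measurable (Pi\<^sub>M {..\<tau>} (\<lambda>_. borel))"
  by (intro inventory_measurable) auto

text \<open>Under the convex cost, the net inventory \<open>Y1\<close> of the lost sales system is cheaper than the net
  inventory \<open>Y2\<close> of a backorder system with the same mean, because both \<open>Y1\<close> and \<open>Y2 - Y1\<close>
  are decreasing in every demand and hence positively correlated.\<close>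

lemma lost_sales_le_backorder:
  assumes "0 \<le> h" "0 \<le> p"
    and mean: "(LINT \<omega>|M. inventory z (\<lambda>i. D (t + i) \<omega>) \<tau>) = S - real \<tau> * mean_demand"
  shows "(LINT \<omega>|M. h * end_inventory z (\<lambda>i. D (t + i) \<omega>) \<tau> + p * lost_sales z (\<lambda>i. D (t + i) \<omega>) \<tau>)
    \<le> (LINT \<omega>|M. h * max 0 (S - X t \<omega>) + p * max 0 (X t \<omega> - S))"
proof -
  define Y1 Y2 where "Y1 x = inventory z x \<tau> - x \<tau>" and "Y2 x = S - (\<Sum>i\<le>\<tau>. x i)" for x
  define \<phi> where "\<phi> y = h * max 0 y + p * max 0 (- y)" for y :: real
  \<comment> \<open>A bounded increasing subgradient of \<open>\<phi>\<close>, so that its value at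
    \<open>Y1 x\<close> is bounded and antitone in \<open>x\<close>, as \<open>Harris\<close>
    demands. At the kink any slope between \<open>- p\<close> and \<open>h\<close> would do.\<close>
  define \<phi>' where "\<phi>' y = (if 0 < y then h else - p)" for y :: real
  have subgradient: "\<phi> y + \<phi>' y * (y' - y) \<le> \<phi> y'" for y y'
  proof -
    have "h * y' \<le> h * max 0 y'" "p * - y' \<le> p * max 0 (- y')"
      using assms by (intro mult_left_mono; simp)+
    moreover have "0 \<le> h * max 0 y'" "0 \<le> p * max 0 (- y')" using assms by auto
    moreover have "\<phi> y + \<phi>' y * (y' - y) = \<phi>' y * y'"
      by (auto simp: \<phi>_def \<phi>'_def algebra_simps)
    ultimately show ?thesis by (auto simp: \<phi>_def \<phi>'_def)
  qed
  let ?B = "Pi\<^sub>M {..\<tau>} (\<lambda>_. borel) :: (nat \<Rightarrow> real) measure"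
  have [measurable_cong]: "sets demand_law = sets ?B" by (rule sets_demand_law)
  note [measurable] = inventory_measurable_window[of \<tau> z, OF order_refl]
  have Y1 [measurable]: "Y1 \<in> borel_measurable ?B" unfolding Y1_def[abs_def] by measurable
  have Y2 [measurable]: "Y2 \<in> borel_measurable ?B" unfolding Y2_def[abs_def] by measurable
  have [measurable]: "\<phi> \<in> borel_measurable borel" "\<phi>' \<in> borel_measurable borel"
    unfolding \<phi>_def[abs_def] \<phi>'_def[abs_def] by measurable
  have w: "Y1 (\<lambda>i\<in>{..\<tau>}. D (t + i) \<omega>) = inventory z (\<lambda>i. D (t + i) \<omega>) \<tau> - D (t + \<tau>) \<omega>"
    "Y2 (\<lambda>i\<in>{..\<tau>}. D (t + i) \<omega>) = S - X t \<omega>" for \<omega>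
    by (auto simp: Y1_def Y2_def intro!: inventory_cong)
  have iM: "integrable M (\<lambda>\<omega>. inventory z (\<lambda>i. D (t + i) \<omega>) \<tau> - D (t + \<tau>) \<omega>)"
    "integrable M (\<lambda>\<omega>. S - X t \<omega>)"
    using inventory_integrable D_integrable by auto
  have i: "integrable demand_law Y1" "integrable demand_law Y2"
    using iM by (simp_all add: integral_window(2)[of _ t] w)
  have i\<phi>: "integrable demand_law (\<lambda>x. \<phi> (Y1 x))" "integrable demand_law (\<lambda>x. \<phi> (Y2 x))"
    unfolding \<phi>_def using i by auto
  interpret Q: prob_space demand_law by (rule prob_space_demand_law)
  \<comment> \<open>By \<open>mean\<close> both net inventories have expectation
    \<open>S - (\<tau> + 1) * mean_demand\<close>, so the product of expectations in
    \<open>Harris\<close> is 0.\<close>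
  have E: "(LINT x|demand_law. Y2 x - Y1 x) = 0"
  proof -
    have "(LINT x|demand_law. Y1 x) = S - real \<tau> * mean_demand - mean_demand"
      using inventory_integrable D_integrable
      by (simp add: integral_window(1)[of _ t] w mean expectation_D)
    moreover have "(LINT x|demand_law. Y2 x) = S - real (Suc \<tau>) * mean_demand"
      using D_integrable by (simp add: integral_window(1)[of _ t] w expectation_D prob_space)
    ultimately show ?thesis using i by (simp add: algebra_simps)
  qed
  have "(LINT x|demand_law. \<phi>' (Y1 x)) * (LINT x|demand_law. Y2 x - Y1 x)
      \<le> (LINT x|demand_law. \<phi>' (Y1 x) * (Y2 x - Y1 x))"
    unfolding demand_law_def
  proof (rule Harris)
    show "\<phi>' (Y1 y) \<le> \<phi>' (Y1 x)" if "\<And>i. i \<in> {..\<tau>} \<Longrightarrow> x i \<le> y i" for x y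
    proof -
      have "Y1 y \<le> Y1 x"
        unfolding Y1_def using that by (intro diff_mono inventory_antimono) auto
      then show ?thesis using assms by (auto simp: \<phi>'_def)
    qed
    \<comment> \<open>The last demand cancels: \<open>Y2 x - Y1 x\<close> is \<open>S\<close> minus
      the sum of the inventory in period \<open>\<tau>\<close> and the demands before it.\<close>
    show "Y2 y - Y1 y \<le> Y2 x - Y1 x" if "\<And>i. i \<in> {..\<tau>} \<Longrightarrow> x i \<le> y i" for x y
      using inventory_plus_demand_mono[of \<tau> x y z] that
      by (simp add: Y1_def Y2_def lessThan_Suc_atMost[symmetric])
    show "\<bar>\<phi>' (Y1 x)\<bar> \<le> max h p" for x using assms by (auto simp: \<phi>'_def)
  qed (use prob_space_single i in \<open>auto simp: demand_law_def[symmetric]\<close>)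
  then have "0 \<le> (LINT x|demand_law. \<phi>' (Y1 x) * (Y2 x - Y1 x))" by (simp add: E)
  also have "\<dots> \<le> (LINT x|demand_law. \<phi> (Y2 x) - \<phi> (Y1 x))"
  proof (rule integral_mono)
    have "\<bar>\<phi>' (Y1 x)\<bar> \<le> max h p" for x using assms by (auto simp: \<phi>'_def)
    then have "\<bar>\<phi>' (Y1 x) * (Y2 x - Y1 x)\<bar> \<le> max h p * \<bar>Y2 x - Y1 x\<bar>" for x
      by (simp add: abs_mult mult_right_mono)
    then have bound: "norm (\<phi>' (Y1 x) * (Y2 x - Y1 x)) \<le> norm (max h p * \<bar>Y2 x - Y1 x\<bar>)" for x
      by (metis abs_ge_self order_trans real_norm_def)
    have "integrable demand_law (\<lambda>x. max h p * \<bar>Y2 x - Y1 x\<bar>)"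
      using i by (intro integrable_mult_right integrable_abs Bochner_Integration.integrable_diff)
    then show "integrable demand_law (\<lambda>x. \<phi>' (Y1 x) * (Y2 x - Y1 x))"
      by (rule Bochner_Integration.integrable_bound[OF _ _ AE_I2[OF bound]]) measurable
    show "\<phi>' (Y1 x) * (Y2 x - Y1 x) \<le> \<phi> (Y2 x) - \<phi> (Y1 x)" for x
      using subgradient[of "Y1 x" "Y2 x"] by simp
  qed (use i\<phi> in auto)
  finally have "(LINT x|demand_law. \<phi> (Y1 x)) \<le> (LINT x|demand_law. \<phi> (Y2 x))"
    using i\<phi> by simp
  then show ?thesis
    by (simp add: integral_window(1)[of _ t] w \<phi>_def end_inventory_def lost_sales_def)
qed

section \<open>The expected inventory under the projected inventory level policy\<close>

text \<open>The history before \<open>t\<close> is frozen at \<open>\<omega>\<close>, while the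
  demands from \<open>t\<close> on are averaged over \<open>\<omega>'\<close>. The order placed in
  period \<open>t\<close> arrives in period \<open>t + \<tau>\<close> on top of the stock left from
  the period before.\<close>

lemma expectation_inventory_pipe:
  "(LINT \<omega>'|M. inventory (pipe A \<omega> t) (\<lambda>i. D (t + i) \<omega>') \<tau>) =
    projected_inventory M D \<tau> t (state \<tau> (orders A \<omega>) (\<lambda>s. D s \<omega>) t) + orders A \<omega> (t + \<tau>)"
proof (cases \<tau>)
  case 0
  then show ?thesis
    by (cases t) (auto simp: pipeline_def projected_inventory_def state_def end_inventory_def prob_space)
next
  case (Suc n)
  let ?x = "state \<tau> (orders A \<omega>) (\<lambda>s. D s \<omega>) t"
  have "inventory (pipe A \<omega> t) (\<lambda>i. D (t + i) \<omega>') \<tau>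
      = end_inventory ?x (\<lambda>i. D (t + i) \<omega>') n + orders A \<omega> (t + \<tau>)" for \<omega>'
  proof -
    have "end_inventory (pipe A \<omega> t) (\<lambda>i. D (t + i) \<omega>') n = end_inventory ?x (\<lambda>i. D (t + i) \<omega>') n"
      using Suc by (intro end_inventory_cong) (auto simp: pipeline_def state_def)
    then show ?thesis using Suc by (simp add: pipeline_def end_inventory_def)
  qed
  moreover have "integrable M (\<lambda>\<omega>'. end_inventory ?x (\<lambda>i. D (t + i) \<omega>') n)"
    unfolding end_inventory_def using inventory_integrable D_integrable by auto
  ultimately show ?thesis using Suc by (simp add: projected_inventory_def prob_space)
qed

text \<open>Demands are stationary; this lets projections made in different periods be computed with
  the same demands.\<close>

lemma projected_inventory_shift:
  "projected_inventory M D \<tau> t x = projected_inventory M D \<tau> 0 x"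
proof (cases "\<tau> = 0")
  case False
  have "(LINT \<omega>|M. end_inventory x (\<lambda>i. D (t + i) \<omega>) (\<tau> - 1)) = (LINT \<omega>|M. end_inventory x (\<lambda>i. D i \<omega>) (\<tau> - 1))"
  proof (rule expectation_shift)
    show "(\<lambda>y. end_inventory x y (\<tau> - 1)) \<in> borel_measurable (Pi\<^sub>M {..\<tau>} (\<lambda>_. borel))"
      by (intro end_inventory_measurable demand_component) auto
    show "end_inventory x (restrict y {..\<tau>}) (\<tau> - 1) = end_inventory x y (\<tau> - 1)" for y
      by (intro end_inventory_cong) auto
  qed
  with False show ?thesis by (simp add: projected_inventory_def)
qed (simp add: projected_inventory_def)

abbreviation pil :: "real \<Rightarrow> policy" where
  "pil U \<equiv> pil_policy M D \<tau> U"

lemma pil_in_policies: "pil U \<in> policies \<tau>"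
  by (rule pil_policy_in_policies) (auto intro: prob_space_axioms)

lemma pil_order:
  "orders (pil U) \<omega> (t + \<tau>) =
    max 0 (U - projected_inventory M D \<tau> t (state \<tau> (orders (pil U) \<omega>) (\<lambda>s. D s \<omega>) t))"
  by (subst order_seq.simps) (simp add: pil_policy_def)

text \<open>Projecting from period \<open>t + 1\<close> amounts to projecting from period \<open>t\<close> with all outstanding orders
  arriving one period earlier, which is why the bound is inherited.\<close>

lemma pil_projected_inventory_le:
  assumes "0 \<le> U" "\<omega> \<in> space M" "\<And>t. 0 \<le> D t \<omega>"
  shows "projected_inventory M D \<tau> t (state \<tau> (orders (pil U) \<omega>) (\<lambda>s. D s \<omega>) t) \<le> U"
proof (induction t)
  case 0
  show ?case
  proof (cases \<tau>)
    case 0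
    then show ?thesis using assms(1) by (simp add: projected_inventory_def state_def)
  next
    case (Suc n)
    let ?x = "state \<tau> (orders (pil U) \<omega>) (\<lambda>s. D s \<omega>) 0"
    \<comment> \<open>The system starts empty and no order arrives before period
      \<open>\<tau>\<close>, so the first projection is at most 0.\<close>
    have x: "?x i = 0" if "i \<le> n" for i
      using that Suc by (auto simp: state_def order_seq.simps)
    have "AE \<omega>' in M. end_inventory ?x (\<lambda>i. D (0 + i) \<omega>') n \<le> U"
      using D_nonneg_all
    proof eventually_elim
      case (elim \<omega>')
      have "inventory ?x (\<lambda>i. D (0 + i) \<omega>') n \<le> (\<Sum>s\<le>n. ?x s)"
        using elim x by (intro inventory_le_sum) auto
      also have "\<dots> = 0" using x by simp
      finally have "inventory ?x (\<lambda>i. D (0 + i) \<omega>') n \<le> 0" .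
      moreover have "0 \<le> D (0 + n) \<omega>'" using elim by simp
      ultimately show ?case using assms(1) by (simp add: end_inventory_def)
    qed
    moreover have "integrable M (\<lambda>\<omega>'. end_inventory ?x (\<lambda>i. D (0 + i) \<omega>') n)"
      unfolding end_inventory_def using inventory_integrable[of ?x 0 n] D_integrable by auto
    ultimately have "(LINT \<omega>'|M. end_inventory ?x (\<lambda>i. D (0 + i) \<omega>') n) \<le> (LINT \<omega>'|M. U)"
      by (intro integral_mono_AE) auto
    then show ?thesis using Suc by (simp add: projected_inventory_def prob_space)
  qed
next
  case (Suc t)
  let ?q = "orders (pil U) \<omega>" and ?d = "\<lambda>s. D s \<omega>"
  \<comment> \<open>By the induction hypothesis the maximum in \<open>pil_order\<close> is not cut
    off at 0, so the order lifts the projection to exactly \<open>U\<close>.\<close>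
  have U: "(LINT \<omega>'|M. inventory (pipe (pil U) \<omega> t) (\<lambda>i. D (t + i) \<omega>') \<tau>) = U"
    using Suc unfolding expectation_inventory_pipe pil_order by simp
  have q: "0 \<le> ?q s" for s using orders_nonneg[OF pil_in_policies assms(2)] .
  show ?case
  proof (cases \<tau>)
    case 0
    then have "inventory ?q ?d t = U" using U by (simp add: pipeline_def prob_space)
    with 0 assms show ?thesis
      by (simp add: projected_inventory_def state_def end_inventory_def)
  next
    case (Suc n)
    let ?x = "state \<tau> ?q ?d (Suc t)"
    \<comment> \<open>Both systems are now driven by the demands \<open>D (t + i) \<omega>'\<close>
      and can be compared path by path; the realised demand \<open>D t \<omega>\<close> only enters
      the initial stock of \<open>?x\<close>.\<close>
    have "projected_inventory M D \<tau> (Suc t) ?x = (LINT \<omega>'|M. end_inventory ?x (\<lambda>i. D (t + i) \<omega>') n)"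
      using Suc projected_inventory_shift[of "Suc t" ?x] projected_inventory_shift[of t ?x]
      by (simp add: projected_inventory_def)
    also have "\<dots> \<le> (LINT \<omega>'|M. inventory (pipe (pil U) \<omega> t) (\<lambda>i. D (t + i) \<omega>') (Suc n))"
    proof (rule integral_mono)
      show "integrable M (\<lambda>\<omega>'. end_inventory ?x (\<lambda>i. D (t + i) \<omega>') n)"
        unfolding end_inventory_def using inventory_integrable D_integrable by auto
      show "end_inventory ?x (\<lambda>i. D (t + i) \<omega>') n
          \<le> inventory (pipe (pil U) \<omega> t) (\<lambda>i. D (t + i) \<omega>') (Suc n)" for \<omega>'
        using Suc
        by (intro early_arrival[where ?d0.0="D t \<omega>"] assms pipeline_nonneg q)
          (auto simp: state_def pipeline_def)
    qed (rule inventory_integrable)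
    also have "\<dots> = U" using U Suc by simp
    finally show ?thesis .
  qed
qed

text \<open>The projection never exceeds \<open>U\<close>, so each order reaches the level exactly.
  This is the hypothesis \<open>mean\<close> of \<open>lost_sales_le_backorder\<close> for
  \<open>S = U + \<tau> * mean_demand\<close>.\<close>

lemma pil_expected_inventory:
  assumes "0 \<le> U" "\<omega> \<in> space M" "\<And>t. 0 \<le> D t \<omega>"
  shows "(LINT \<omega>'|M. inventory (pipe (pil U) \<omega> t) (\<lambda>i. D (t + i) \<omega>') \<tau>) = U"
  using pil_projected_inventory_le[OF assms, of t] unfolding expectation_inventory_pipe pil_order by simp

section \<open>Newsvendor bounds on the cost-rate\<close>

lemma restrict_pipe_cong:
  "end_inventory (restrict z {..\<tau>}) (restrict x {..\<tau>}) \<tau> = end_inventory z x \<tau>"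
  "i \<le> \<tau> \<Longrightarrow> lost_sales (restrict z {..\<tau>}) (restrict x {..\<tau>}) i = lost_sales z x i"
proof -
  have "inventory (restrict z {..\<tau>}) (restrict x {..\<tau>}) i = inventory z x i" if "i \<le> \<tau>" for i
    using that by (intro inventory_cong) auto
  then show "end_inventory (restrict z {..\<tau>}) (restrict x {..\<tau>}) \<tau> = end_inventory z x \<tau>"
    "i \<le> \<tau> \<Longrightarrow> lost_sales (restrict z {..\<tau>}) (restrict x {..\<tau>}) i = lost_sales z x i"
    by (auto simp: end_inventory_def lost_sales_def)
qed

text \<open>The pipeline at \<open>t\<close> is independent of the demands from \<open>t\<close> on,
  which may therefore be replaced by a fresh copy. Weights \<open>w\<close> concentrated at
  \<open>\<tau>\<close> give the cost of one period; constant weights give the charge to a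
  window.\<close>

lemma nn_integral_pipe:
  assumes A: "A \<in> policies \<tau>"
  shows "(\<integral>\<^sup>+\<omega>. ennreal (h * end_inventory (pipe A \<omega> t) (\<lambda>i. D (t + i) \<omega>) \<tau>
        + (\<Sum>i\<le>\<tau>. w i * lost_sales (pipe A \<omega> t) (\<lambda>i. D (t + i) \<omega>) i)) \<partial>M)
    = (\<integral>\<^sup>+\<omega>. \<integral>\<^sup>+\<omega>'. ennreal (h * end_inventory (pipe A \<omega> t) (\<lambda>i. D (t + i) \<omega>') \<tau>
        + (\<Sum>i\<le>\<tau>. w i * lost_sales (pipe A \<omega> t) (\<lambda>i. D (t + i) \<omega>') i)) \<partial>M \<partial>M)"
proof -
  let ?B = "Pi\<^sub>M {..\<tau>} (\<lambda>_. borel) :: (nat \<Rightarrow> real) measure"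
  let ?F = "\<lambda>z. ennreal (h * end_inventory (fst z) (snd z) \<tau> + (\<Sum>i\<le>\<tau>. w i * lost_sales (fst z) (snd z) i))"
  have f: "(\<lambda>z. fst z i) \<in> borel_measurable (?B \<Otimes>\<^sub>M ?B)" if "i \<le> \<tau>" for i
    using that by (intro measurable_compose[OF measurable_fst]) auto
  have s: "(\<lambda>z. snd z i) \<in> borel_measurable (?B \<Otimes>\<^sub>M ?B)" if "i \<le> \<tau>" for i
    using that by (intro measurable_compose[OF measurable_snd]) auto
  have e: "(\<lambda>z. end_inventory (fst z) (snd z) \<tau>) \<in> borel_measurable (?B \<Otimes>\<^sub>M ?B)"
    by (intro end_inventory_measurable f s)
  have l: "(\<lambda>z. lost_sales (fst z) (snd z) i) \<in> borel_measurable (?B \<Otimes>\<^sub>M ?B)" if "i \<le> \<tau>" for i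
    unfolding lost_sales_def using that
    by (intro borel_measurable_max borel_measurable_diff inventory_measurable borel_measurable_const f s) auto
  have "?F \<in> borel_measurable (?B \<Otimes>\<^sub>M ?B)"
    by (intro measurable_compose[OF _ measurable_ennreal] borel_measurable_add borel_measurable_times
        borel_measurable_sum borel_measurable_const e l) auto
  from nn_integral_indep_pair[OF indep_pipe[OF A] this, of t] show ?thesis
    by (simp add: restrict_pipe_cong)
qed

lemma lead_time_demand_eq: "lead_time_demand D \<tau> = X 0"
  by (auto simp: lead_time_demand_def atLeast0AtMost)

lemma newsvendor_cost_window:
  "(LINT \<omega>|M. h * max 0 (S - X t \<omega>) + p * max 0 (X t \<omega> - S)) = newsvendor_cost M (lead_time_demand D \<tau>) h p S"
proof -
  have "(LINT \<omega>|M. h * max 0 (S - X t \<omega>) + p * max 0 (X t \<omega> - S))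
      = (LINT \<omega>|M. h * max 0 (S - X 0 \<omega>) + p * max 0 (X 0 \<omega> - S))"
    using expectation_shift[of "\<lambda>x. h * max 0 (S - (\<Sum>i\<le>\<tau>. x i)) + p * max 0 ((\<Sum>i\<le>\<tau>. x i) - S)" t]
    by simp
  then show ?thesis unfolding lead_time_demand_eq newsvendor_cost_def .
qed

lemma newsvendor_cost_integrable:
  "integrable M (\<lambda>\<omega>. h * max 0 (S - X t \<omega>) + p * max 0 (X t \<omega> - S))"
  using D_integrable by auto

section \<open>Cost-rates as averages of period costs\<close>

definition period_cost :: "real \<Rightarrow> real \<Rightarrow> policy \<Rightarrow> nat \<Rightarrow> 'a \<Rightarrow> real" where
  "period_cost h p A t \<omega> = h * end_inventory (orders A \<omega>) (\<lambda>s. D s \<omega>) t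
     + p * lost_sales (orders A \<omega>) (\<lambda>s. D s \<omega>) t"

lemma period_cost_nonneg: "0 \<le> h \<Longrightarrow> 0 \<le> p \<Longrightarrow> 0 \<le> period_cost h p A t \<omega>"
  by (simp add: period_cost_def end_inventory_nonneg lost_sales_nonneg)

lemma path_measurable:
  assumes "A \<in> policies \<tau>"
  shows "(\<lambda>\<omega>. end_inventory (orders A \<omega>) (\<lambda>s. D s \<omega>) t) \<in> borel_measurable M"
    and "(\<lambda>\<omega>. lost_sales (orders A \<omega>) (\<lambda>s. D s \<omega>) t) \<in> borel_measurable M"
  unfolding end_inventory_def lost_sales_def
  by (intro borel_measurable_max borel_measurable_diff inventory_measurable orders_measurable assms
      borel_measurable_const D_measurable)+

lemma period_cost_measurable:
  "A \<in> policies \<tau> \<Longrightarrow> period_cost h p A t \<in> borel_measurable M"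
  unfolding period_cost_def[abs_def] using path_measurable[of A t] by auto

lemma cost_rate_eq:
  assumes "A \<in> policies \<tau>" "0 \<le> h" "0 \<le> p"
  shows "cost_rate M D \<tau> h p A =
    limsup (\<lambda>T. ennreal (1 / (real T - real \<tau> + 1)) * (\<integral>\<^sup>+\<omega>. ennreal (\<Sum>t=\<tau>..T. period_cost h p A t \<omega>) \<partial>M))"
  unfolding cost_rate_def Let_def
proof (rule arg_cong[where f=limsup], rule ext)
  fix T
  have [measurable]: "period_cost h p A t \<in> borel_measurable M" for t
    by (rule period_cost_measurable[OF assms(1)])
  show "(\<integral>\<^sup>+\<omega>. ennreal (1 / (real T - real \<tau> + 1) *
      (\<Sum>t=\<tau>..T. h * end_inventory (orders A \<omega>) (\<lambda>s. D s \<omega>) t + p * lost_sales (orders A \<omega>) (\<lambda>s. D s \<omega>) t)) \<partial>M)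
    = ennreal (1 / (real T - real \<tau> + 1)) * (\<integral>\<^sup>+\<omega>. ennreal (\<Sum>t=\<tau>..T. period_cost h p A t \<omega>) \<partial>M)"
  \<comment> \<open>For \<open>T < \<tau>\<close> both sides are 0 because the sum is empty;
    otherwise the factor is positive and can be split off inside \<open>ennreal\<close>.\<close>
  proof (cases "\<tau> \<le> T")
    case True
    have "ennreal (1 / (real T - real \<tau> + 1) * (\<Sum>t=\<tau>..T. period_cost h p A t \<omega>))
        = ennreal (1 / (real T - real \<tau> + 1)) * ennreal (\<Sum>t=\<tau>..T. period_cost h p A t \<omega>)" for \<omega>
      using True assms by (intro ennreal_mult sum_nonneg period_cost_nonneg) auto
    then show ?thesis
      unfolding period_cost_def[symmetric] by (simp del: times_divide_eq_left add: nn_integral_cmult)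
  qed simp
qed

text \<open>Every period from \<open>\<tau>\<close> on ends the window that starts
  \<open>\<tau>\<close> periods earlier. Given the history at that start, its expected cost is at
  most that of a backorder system with level \<open>U + \<tau> * mean_demand\<close>.\<close>

lemma pil_cost_rate_le:
  assumes "0 \<le> U" "0 \<le> h" "0 \<le> p"
  shows "cost_rate M D \<tau> h p (pil U)
    \<le> ennreal (newsvendor_cost M (lead_time_demand D \<tau>) h p (U + real \<tau> * mean_demand))"
proof -
  let ?c = "period_cost h p (pil U)" and ?G = "newsvendor_cost M (lead_time_demand D \<tau>) h p (U + real \<tau> * mean_demand)"
  have period: "(\<integral>\<^sup>+\<omega>. ennreal (?c t \<omega>) \<partial>M) \<le> ennreal ?G" if t_ge: "\<tau> \<le> t" for t
  proof -
    obtain s where t: "t = s + \<tau>" using le_add_diff_inverse2[OF t_ge] by metis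
    let ?I = "\<lambda>\<omega> \<omega>'. h * end_inventory (pipe (pil U) \<omega> s) (\<lambda>i. D (s + i) \<omega>') \<tau>
      + p * lost_sales (pipe (pil U) \<omega> s) (\<lambda>i. D (s + i) \<omega>') \<tau>"
    have "(\<integral>\<^sup>+\<omega>. ennreal (?c t \<omega>) \<partial>M) = (\<integral>\<^sup>+\<omega>. \<integral>\<^sup>+\<omega>'. ennreal (?I \<omega> \<omega>') \<partial>M \<partial>M)"
    proof -
      have "(\<Sum>i\<le>\<tau>. (if i = \<tau> then p else 0) * f i) = p * f \<tau>" for f :: "nat \<Rightarrow> real"
      proof -
        have "(\<Sum>i\<le>\<tau>. (if i = \<tau> then p else 0) * f i) = (\<Sum>i\<le>\<tau>. if i = \<tau> then p * f i else 0)"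
          by (intro sum.cong) auto
        then show ?thesis by simp
      qed
      with nn_integral_pipe[OF pil_in_policies[of U], of h s "\<lambda>i. if i = \<tau> then p else 0"]
      show ?thesis
        unfolding t period_cost_def end_inventory_pipeline lost_sales_pipeline by simp
    qed
    also have "\<dots> \<le> (\<integral>\<^sup>+\<omega>. ennreal ?G \<partial>M)"
    proof (rule nn_integral_mono_AE)
      show "AE \<omega> in M. (\<integral>\<^sup>+\<omega>'. ennreal (?I \<omega> \<omega>') \<partial>M) \<le> ennreal ?G"
        using D_nonneg_all AE_space
      proof eventually_elim
        case (elim \<omega>)
        have "integrable M (?I \<omega>)"
          unfolding end_inventory_def lost_sales_def using inventory_integrable D_integrable by auto
        then have "(\<integral>\<^sup>+\<omega>'. ennreal (?I \<omega> \<omega>') \<partial>M) = ennreal (LINT \<omega>'|M. ?I \<omega> \<omega>')"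
          using assms by (intro nn_integral_eq_integral)
            (auto simp: end_inventory_nonneg lost_sales_nonneg)
        also have "\<dots> \<le> ennreal ?G"
          using lost_sales_le_backorder[of h p "pipe (pil U) \<omega> s" s "U + real \<tau> * mean_demand"] assms
            pil_expected_inventory[of U \<omega> s] elim
          unfolding newsvendor_cost_window by (intro ennreal_leI) simp
        finally show ?case .
      qed
    qed
    also have "\<dots> = ennreal ?G" by (simp add: emeasure_space_1)
    finally show ?thesis .
  qed
  have G: "0 \<le> ?G" unfolding newsvendor_cost_def using assms by (intro integral_nonneg_AE AE_I2) simp
  have "\<forall>\<^sub>F T in sequentially. ennreal (1 / (real T - real \<tau> + 1)) * (\<integral>\<^sup>+\<omega>. ennreal (\<Sum>t=\<tau>..T. ?c t \<omega>) \<partial>M) \<le> ennreal ?G"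
    using eventually_ge_at_top[of \<tau>]
  proof eventually_elim
    case (elim T)
    have [measurable]: "?c t \<in> borel_measurable M" for t
      by (rule period_cost_measurable[OF pil_in_policies])
    have "(\<integral>\<^sup>+\<omega>. ennreal (\<Sum>t=\<tau>..T. ?c t \<omega>) \<partial>M) = (\<Sum>t=\<tau>..T. \<integral>\<^sup>+\<omega>. ennreal (?c t \<omega>) \<partial>M)"
      using assms by (subst nn_integral_sum[symmetric]) (auto simp: sum_ennreal period_cost_nonneg)
    also have "\<dots> \<le> (\<Sum>t=\<tau>..T. ennreal ?G)" by (intro sum_mono period) simp
    also have "\<dots> = ennreal (\<Sum>t=\<tau>..T. ?G)" using G by (intro sum_ennreal)
    also have "\<dots> = ennreal ((real T - real \<tau> + 1) * ?G)" using elim by (simp add: of_nat_diff add.commute add_diff_eq)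
    finally have "ennreal (1 / (real T - real \<tau> + 1)) * (\<integral>\<^sup>+\<omega>. ennreal (\<Sum>t=\<tau>..T. ?c t \<omega>) \<partial>M)
        \<le> ennreal (1 / (real T - real \<tau> + 1)) * ennreal ((real T - real \<tau> + 1) * ?G)"
      by (intro mult_left_mono) auto
    also have "\<dots> = ennreal ?G" using elim by (subst ennreal_mult''[symmetric]) (auto simp: G)
    finally show ?case .
  qed
  then show ?thesis
    unfolding cost_rate_eq[OF pil_in_policies assms(2,3)] by (rule Limsup_bounded)
qed

text \<open>Every period lies in at most \<open>\<tau> + 1\<close> windows of length \<open>\<tau> + 1\<close>, so a window is charged a
  fraction \<open>1 / (\<tau> + 1)\<close> of the penalties incurred in it.\<close>

lemma sum_windows_le:
  fixes f :: "nat \<Rightarrow> real"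
  assumes "\<And>t. 0 \<le> f t" "i \<le> n"
  shows "(\<Sum>t=n..<n + m. f (t + i)) \<le> (\<Sum>s=n..<n + m + n. f s)"
proof -
  have "(\<Sum>t=n..<n + m. f (t + i)) = (\<Sum>s=n + i..<n + m + i. f s)"
    by (rule sum.shift_bounds_nat_ivl[symmetric])
  also have "\<dots> \<le> (\<Sum>s=n..<n + m + n. f s)"
    using assms by (intro sum_mono2) auto
  finally show ?thesis .
qed

text \<open>By \<open>end_inventory_balance\<close>, a window with total supply \<open>S\<close>
  ends with stock at least \<open>max 0 (S - X)\<close> and loses at least
  \<open>max 0 (X - S)\<close> in all. Whatever \<open>S\<close> the policy has chosen,
  \<open>G\<close> bounds the resulting newsvendor cost from below.\<close>

lemma cost_rate_ge:
  assumes A: "A \<in> policies \<tau>" and h: "0 \<le> h" and p: "0 \<le> p"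
    and G: "\<And>S. G \<le> newsvendor_cost M (lead_time_demand D \<tau>) h (p / real (Suc \<tau>)) S" and "0 \<le> G"
  shows "ennreal G \<le> cost_rate M D \<tau> h p A"
proof -
  let ?p = "p / real (Suc \<tau>)" and ?c = "period_cost h p A"
  let ?J = "\<lambda>\<omega> t. end_inventory (orders A \<omega>) (\<lambda>s. D s \<omega>) t" and ?L = "\<lambda>\<omega> t. lost_sales (orders A \<omega>) (\<lambda>s. D s \<omega>) t"
  define W where "W t \<omega> = h * ?J \<omega> (t + \<tau>) + (\<Sum>i\<le>\<tau>. ?p * ?L \<omega> (t + i))" for t \<omega>
  have W_nonneg: "0 \<le> W t \<omega>" for t \<omega>
    unfolding W_def using h p
    by (intro add_nonneg_nonneg mult_nonneg_nonneg sum_nonneg end_inventory_nonneg lost_sales_nonneg) auto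
  have W [measurable]: "W t \<in> borel_measurable M" for t
    unfolding W_def[abs_def] using path_measurable[OF A] by auto
  have window: "ennreal G \<le> (\<integral>\<^sup>+\<omega>. ennreal (W t \<omega>) \<partial>M)" for t
  proof -
    have "ennreal G = (\<integral>\<^sup>+\<omega>. ennreal G \<partial>M)" by (simp add: emeasure_space_1)
    also have "\<dots> \<le> (\<integral>\<^sup>+\<omega>. \<integral>\<^sup>+\<omega>'. ennreal (h * end_inventory (pipe A \<omega> t) (\<lambda>i. D (t + i) \<omega>') \<tau>
        + (\<Sum>i\<le>\<tau>. ?p * lost_sales (pipe A \<omega> t) (\<lambda>i. D (t + i) \<omega>') i)) \<partial>M \<partial>M)"
    proof (rule nn_integral_mono)
      fix \<omega>
      let ?S = "\<Sum>i\<le>\<tau>. pipe A \<omega> t i"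
      have "ennreal G \<le> ennreal (LINT \<omega>'|M. h * max 0 (?S - X t \<omega>') + ?p * max 0 (X t \<omega>' - ?S))"
        unfolding newsvendor_cost_window by (intro ennreal_leI G)
      also have "\<dots> = (\<integral>\<^sup>+\<omega>'. ennreal (h * max 0 (?S - X t \<omega>') + ?p * max 0 (X t \<omega>' - ?S)) \<partial>M)"
        using h p by (intro nn_integral_eq_integral[symmetric] newsvendor_cost_integrable) auto
      also have "\<dots> \<le> (\<integral>\<^sup>+\<omega>'. ennreal (h * end_inventory (pipe A \<omega> t) (\<lambda>i. D (t + i) \<omega>') \<tau>
        + (\<Sum>i\<le>\<tau>. ?p * lost_sales (pipe A \<omega> t) (\<lambda>i. D (t + i) \<omega>') i)) \<partial>M)"
      proof (intro nn_integral_mono ennreal_leI)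
        fix \<omega>'
        let ?J' = "end_inventory (pipe A \<omega> t) (\<lambda>i. D (t + i) \<omega>') \<tau>"
        let ?L' = "\<Sum>i\<le>\<tau>. lost_sales (pipe A \<omega> t) (\<lambda>i. D (t + i) \<omega>') i"
        have "?J' = ?S - X t \<omega>' + ?L'" by (rule end_inventory_balance)
        moreover have "0 \<le> ?J'" "0 \<le> ?L'"
          by (auto intro!: sum_nonneg end_inventory_nonneg lost_sales_nonneg)
        ultimately have "max 0 (?S - X t \<omega>') \<le> ?J'" "max 0 (X t \<omega>' - ?S) \<le> ?L'" by auto
        then show "h * max 0 (?S - X t \<omega>') + ?p * max 0 (X t \<omega>' - ?S)
            \<le> h * ?J' + (\<Sum>i\<le>\<tau>. ?p * lost_sales (pipe A \<omega> t) (\<lambda>i. D (t + i) \<omega>') i)"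
          unfolding sum_distrib_left[symmetric] using h p by (intro add_mono mult_left_mono) auto
      qed
      finally show "ennreal G \<le> \<dots>" .
    qed
    also have "\<dots> = (\<integral>\<^sup>+\<omega>. ennreal (W t \<omega>) \<partial>M)"
      unfolding W_def end_inventory_pipeline lost_sales_pipeline by (rule nn_integral_pipe[OF A, symmetric])
    finally show ?thesis .
  qed
  have path: "(\<Sum>t=\<tau>..<\<tau> + m. W t \<omega>) \<le> (\<Sum>s=\<tau>..<\<tau> + m + \<tau>. ?c s \<omega>)" for m \<omega>
  proof -
    have J: "(\<Sum>t=\<tau>..<\<tau> + m. ?J \<omega> (t + \<tau>)) \<le> (\<Sum>s=\<tau>..<\<tau> + m + \<tau>. ?J \<omega> s)"
      by (rule sum_windows_le) (auto intro: end_inventory_nonneg)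
    have "(\<Sum>t=\<tau>..<\<tau> + m. \<Sum>i\<le>\<tau>. ?L \<omega> (t + i)) = (\<Sum>i\<le>\<tau>. \<Sum>t=\<tau>..<\<tau> + m. ?L \<omega> (t + i))"
      by (rule sum.swap)
    also have "\<dots> \<le> (\<Sum>i\<le>\<tau>. \<Sum>s=\<tau>..<\<tau> + m + \<tau>. ?L \<omega> s)"
      by (intro sum_mono sum_windows_le) (auto intro: lost_sales_nonneg)
    also have "\<dots> = real (Suc \<tau>) * (\<Sum>s=\<tau>..<\<tau> + m + \<tau>. ?L \<omega> s)" by simp
    finally have "?p * (\<Sum>t=\<tau>..<\<tau> + m. \<Sum>i\<le>\<tau>. ?L \<omega> (t + i)) \<le> ?p * (real (Suc \<tau>) * (\<Sum>s=\<tau>..<\<tau> + m + \<tau>. ?L \<omega> s))"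
      using p by (intro mult_left_mono) auto
    also have "\<dots> = p * (\<Sum>s=\<tau>..<\<tau> + m + \<tau>. ?L \<omega> s)" by simp
    finally have L: "?p * (\<Sum>t=\<tau>..<\<tau> + m. \<Sum>i\<le>\<tau>. ?L \<omega> (t + i)) \<le> p * (\<Sum>s=\<tau>..<\<tau> + m + \<tau>. ?L \<omega> s)" .
    have "(\<Sum>t=\<tau>..<\<tau> + m. W t \<omega>) = h * (\<Sum>t=\<tau>..<\<tau> + m. ?J \<omega> (t + \<tau>)) + ?p * (\<Sum>t=\<tau>..<\<tau> + m. \<Sum>i\<le>\<tau>. ?L \<omega> (t + i))"
      unfolding W_def by (simp only: sum.distrib sum_distrib_left)
    also have "\<dots> \<le> h * (\<Sum>s=\<tau>..<\<tau> + m + \<tau>. ?J \<omega> s) + p * (\<Sum>s=\<tau>..<\<tau> + m + \<tau>. ?L \<omega> s)"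
      using J L h by (intro add_mono mult_left_mono) auto
    also have "\<dots> = (\<Sum>s=\<tau>..<\<tau> + m + \<tau>. ?c s \<omega>)"
      unfolding period_cost_def by (simp only: sum.distrib sum_distrib_left)
    finally show ?thesis .
  qed
  have "\<forall>\<^sub>F T in sequentially. ennreal ((real T - 2 * real \<tau> + 1) / (real T - real \<tau> + 1) * G)
      \<le> ennreal (1 / (real T - real \<tau> + 1)) * (\<integral>\<^sup>+\<omega>. ennreal (\<Sum>t=\<tau>..T. ?c t \<omega>) \<partial>M)"
    using eventually_ge_at_top[of "2 * \<tau>"]
  proof eventually_elim
    case (elim T)
    \<comment> \<open>The windows that start in period \<open>\<tau>\<close> or later and end by
      \<open>T\<close> have starts \<open>\<tau>\<close> to \<open>T - \<tau>\<close>. They are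
      \<open>\<tau>\<close> fewer than the periods averaged over, a difference that vanishes in the
      limit.\<close>
    define m where "m = T + 1 - 2 * \<tau>"
    have m: "\<tau> + m + \<tau> = Suc T" "real m = real T - 2 * real \<tau> + 1" using elim by (auto simp: m_def)
    have "ennreal (real m * G) = (\<Sum>t=\<tau>..<\<tau> + m. ennreal G)"
      using \<open>0 \<le> G\<close> by (simp add: ennreal_mult ennreal_of_nat_eq_real_of_nat)
    also have "\<dots> \<le> (\<Sum>t=\<tau>..<\<tau> + m. \<integral>\<^sup>+\<omega>. ennreal (W t \<omega>) \<partial>M)" by (intro sum_mono window)
    also have "\<dots> = (\<integral>\<^sup>+\<omega>. ennreal (\<Sum>t=\<tau>..<\<tau> + m. W t \<omega>) \<partial>M)"
      using W_nonneg by (subst nn_integral_sum[symmetric]) (auto simp: sum_ennreal)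
    also have "\<dots> \<le> (\<integral>\<^sup>+\<omega>. ennreal (\<Sum>t=\<tau>..T. ?c t \<omega>) \<partial>M)"
      using path[of _ m] by (intro nn_integral_mono ennreal_leI) (simp add: m atLeastLessThanSuc_atLeastAtMost)
    finally have "ennreal (1 / (real T - real \<tau> + 1)) * ennreal (real m * G)
        \<le> ennreal (1 / (real T - real \<tau> + 1)) * (\<integral>\<^sup>+\<omega>. ennreal (\<Sum>t=\<tau>..T. ?c t \<omega>) \<partial>M)"
      by (intro mult_left_mono) auto
    moreover have "ennreal (1 / (real T - real \<tau> + 1)) * ennreal (real m * G)
        = ennreal ((real T - 2 * real \<tau> + 1) / (real T - real \<tau> + 1) * G)"
      using elim \<open>0 \<le> G\<close> by (subst ennreal_mult''[symmetric]) (auto simp: m)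
    ultimately show ?case by simp
  qed
  then have "limsup (\<lambda>T. ennreal ((real T - 2 * real \<tau> + 1) / (real T - real \<tau> + 1) * G)) \<le> cost_rate M D \<tau> h p A"
    unfolding cost_rate_eq[OF A h p] by (rule Limsup_mono)
  moreover have "(\<lambda>T. (real T - 2 * real \<tau> + 1) / (real T - real \<tau> + 1) * G) \<longlonglongrightarrow> 1 * G"
    by (intro tendsto_mult tendsto_const) real_asymp
  then have "limsup (\<lambda>T. ennreal ((real T - 2 * real \<tau> + 1) / (real T - real \<tau> + 1) * G)) = ennreal G"
    by (intro lim_imp_Limsup tendsto_ennrealI) auto
  ultimately show ?thesis by simp
qed

end

section \<open>Asymptotic optimality\<close>

theorem theorem4:
  fixes M :: "'a measure" and D :: "nat \<Rightarrow> 'a \<Rightarrow> real" and \<tau> :: nat and h \<mu> :: real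
  assumes "prob_space M"
    and "prob_space.indep_vars M (\<lambda>_. borel) D UNIV"
    and "\<And>t. distr M borel (D t) = distr M borel (D 0)"
    and "\<And>t. AE \<omega> in M. 0 \<le> D t \<omega>"
    and "\<And>t. integrable M (D t)"
    and "\<mu> = (LINT \<omega>|M. D 0 \<omega>)"
    and "0 < h"
    and "integrable M (lead_time_demand D \<tau>)"
    and "ess_bounded M (lead_time_demand D \<tau>) \<or>
         \<not> ess_bounded M (lead_time_demand D \<tau>) \<and>
         ((\<lambda>x. mean_excess M (lead_time_demand D \<tau>) x / x) \<longlongrightarrow> 0) at_top"
    and "\<And>p. 0 < p \<Longrightarrow> 0 < optimal_cost_rate M D \<tau> h p"
  shows "((\<lambda>p. cost_rate M D \<tau> h p
              (pil_policy M D \<tau> (max 0 (newsvendor_level M D \<tau> h p - real \<tau> * \<mu>)))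
            / optimal_cost_rate M D \<tau> h p) \<longlongrightarrow> 1) at_top \<and>
         (\<forall>Ustar :: real \<Rightarrow> real.
            (\<forall>p>0. is_arg_min (\<lambda>U. cost_rate M D \<tau> h p (pil_policy M D \<tau> U))
                     (\<lambda>U. 0 \<le> U) (Ustar p)) \<longrightarrow>
            ((\<lambda>p. cost_rate M D \<tau> h p (pil_policy M D \<tau> (Ustar p))
              / optimal_cost_rate M D \<tau> h p) \<longlongrightarrow> 1) at_top)"
proof -
  interpret prob_space M by fact
  interpret iid_demand M D \<tau>
    using assms(2-5) by unfold_locales auto
  have X_int: "integrable M (lead_time_demand D \<tau>)" by fact
  have X_nonneg: "AE \<omega> in M. 0 \<le> lead_time_demand D \<tau> \<omega>"
    using D_nonneg_all by eventually_elim (auto simp: lead_time_demand_def intro: sum_nonneg)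
  interpret newsvendor M "lead_time_demand D \<tau>" h
    using X_int X_nonneg \<open>0 < h\<close> by unfold_locales
  define k G C where "k = real (Suc \<tau>)" and "G p = cost p (quantile p)"
    and "C p = optimal_cost_rate M D \<tau> h p" for p
  define V where "V p = max 0 (newsvendor_level M D \<tau> h p - real \<tau> * \<mu>)" for p
  have k: "1 \<le> k" by (simp add: k_def)
  have level: "newsvendor_level M D \<tau> h p = quantile p" for p
    by (simp add: newsvendor_level_def newsvendor_quantile_def)
  have \<mu>: "mean_demand = \<mu>" using assms(6) by (simp add: mean_demand_def)
  have C_pos: "0 < C p" if "0 < p" for p unfolding C_def by (rule assms(10)[OF that])
  have C_le: "C p \<le> cost_rate M D \<tau> h p A" if "A \<in> policies \<tau>" for p A
    unfolding C_def optimal_cost_rate_def using that by (rule INF_lower)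
  have lower: "ennreal (G (p / k)) \<le> C p" if "0 < p" for p
    unfolding C_def optimal_cost_rate_def G_def
  proof (rule INF_greatest)
    fix A assume "A \<in> policies \<tau>"
    moreover have "0 < p / k" using that k by simp
    ultimately show "ennreal (cost (p / k) (quantile (p / k))) \<le> cost_rate M D \<tau> h p A"
      using that h_pos quantile_optimal cost_nonneg by (intro cost_rate_ge) (auto simp: k_def)
  qed
  have EX: "expectation (lead_time_demand D \<tau>) = k * \<mu>"
    unfolding lead_time_demand_eq expectation_X \<mu> k_def ..
  have "0 \<le> \<mu>" unfolding assms(6) using D_nonneg by (rule integral_nonneg_AE)
  \<comment> \<open>With mean demand 0 the policy with \<open>U = 0\<close> would cost nothing,
    against the positivity of the optimal cost-rate.\<close>
  moreover have "\<mu> \<noteq> 0"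
  proof
    assume "\<mu> = 0"
    have "cost 1 0 = expectation (lead_time_demand D \<tau>)"
      unfolding newsvendor_cost_def using X_nonneg
      by (intro integral_cong_AE) (auto elim!: eventually_mono)
    then have "cost_rate M D \<tau> h 1 (pil 0) \<le> 0"
      using pil_cost_rate_le[of 0 h 1] h_pos by (simp add: EX \<mu> \<open>\<mu> = 0\<close>)
    with C_le[OF pil_in_policies[of 0], of 1] C_pos[of 1] show False by simp
  qed
  ultimately have "0 < \<mu>" by simp
  \<comment> \<open>The mean \<open>(\<tau> + 1) * \<mu>\<close> exceeds
    \<open>\<tau> * \<mu>\<close>. Hence the quantile eventually reaches
    \<open>\<tau> * \<mu>\<close>, and the cut-off at 0 in \<open>V\<close> becomes
    inactive.\<close>
  have "prob {\<omega>\<in>space M. lead_time_demand D \<tau> \<omega> \<le> real \<tau> * \<mu>} < 1"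
  proof (rule ccontr)
    assume "\<not> ?thesis"
    then have "prob {\<omega>\<in>space M. lead_time_demand D \<tau> \<omega> \<le> real \<tau> * \<mu>} = 1"
      using prob_le_1 by (simp add: order_antisym not_less)
    then have "AE \<omega> in M. lead_time_demand D \<tau> \<omega> \<le> real \<tau> * \<mu>"
      by (subst (asm) prob_Collect_eq_1) auto
    then have "expectation (lead_time_demand D \<tau>) \<le> expectation (\<lambda>_. real \<tau> * \<mu>)"
      using X_int by (intro integral_mono_AE) auto
    with \<open>0 < \<mu>\<close> show False by (simp add: EX k_def prob_space algebra_simps)
  qed
  then have "\<forall>\<^sub>F p in at_top. real \<tau> * \<mu> \<le> quantile p" by (rule quantile_eventually_ge)
  with eventually_gt_at_top[of 0]
  have ev: "\<forall>\<^sub>F p in at_top. 0 < p \<and> cost_rate M D \<tau> h p (pil (V p)) \<le> ennreal (G p) \<and> 0 < G p"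
  proof eventually_elim
    case (elim p)
    then have "V p = quantile p - real \<tau> * \<mu>" by (simp add: V_def level)
    then have "cost_rate M D \<tau> h p (pil (V p)) \<le> ennreal (G p)"
      using pil_cost_rate_le[of "V p" h p] elim h_pos by (simp add: \<mu> G_def)
    with C_le[OF pil_in_policies[of "V p"], of p] C_pos[OF elim(1)] elim(1) show ?case
      by (metis ennreal_less_zero_iff order_less_le_trans)
  qed
  have "((\<lambda>p. G (k * p) / G p) \<longlongrightarrow> 1) at_top"
  proof (cases "ess_bounded M (lead_time_demand D \<tau>)")
    case True
    from eventually_happens'[OF _ ev] obtain p0 where "0 < p0" "0 < G p0" by auto
    with True k show ?thesis
      unfolding G_def by (intro optimal_cost_ratio_tendsto_bounded) auto
  next
    case False
    with assms(9) k show ?thesis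
      unfolding G_def by (intro optimal_cost_ratio_tendsto_unbounded) auto
  qed
  moreover have "filterlim (\<lambda>p. p / k) at_top at_top"
    using k filterlim_tendsto_pos_mult_at_top[OF tendsto_const[of "1 / k"] _ filterlim_ident] by simp
  \<comment> \<open>Substituting \<open>p / k\<close> for \<open>p\<close> turns the growth ratio of
    \<open>G\<close> into the ratio of the upper bound \<open>G p\<close> to the lower bound
    \<open>G (p / k)\<close>.\<close>
  ultimately have ratio: "((\<lambda>p. G p / G (p / k)) \<longlongrightarrow> 1) at_top"
    and ev_scaled: "\<forall>\<^sub>F p in at_top. 0 < G (p / k)"
    using k filterlim_compose[of "\<lambda>p. G (k * p) / G p" _ _ "\<lambda>p. p / k"]
      eventually_compose_filterlim[OF eventually_mono[OF ev], of "\<lambda>p. 0 < G p" "\<lambda>p. p / k"] by auto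
  \<comment> \<open>Stated for any levels no worse than \<open>V\<close>, which covers both
    \<open>V\<close> itself and the minimisers \<open>Ustar\<close>.\<close>
  have squeeze: "((\<lambda>p. cost_rate M D \<tau> h p (pil (u p)) / C p) \<longlongrightarrow> 1) at_top"
    if u: "\<And>p. 0 < p \<Longrightarrow> cost_rate M D \<tau> h p (pil (u p)) \<le> cost_rate M D \<tau> h p (pil (V p))" for u
  proof -
    have bounds: "\<forall>\<^sub>F p in at_top. 1 \<le> cost_rate M D \<tau> h p (pil (u p)) / C p \<and>
       cost_rate M D \<tau> h p (pil (u p)) / C p \<le> ennreal (G p / G (p / k))"
      using ev ev_scaled
    proof eventually_elim
      case (elim p)
      let ?c = "cost_rate M D \<tau> h p (pil (u p))"
      have c: "?c \<le> ennreal (G p)" using u[of p] elim by (auto intro: order_trans)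
      have Cc: "C p \<le> ?c" by (rule C_le[OF pil_in_policies])
      \<comment> \<open>In \<open>ennreal\<close> a quotient \<open>C p / C p\<close> is 1 only for
        finite nonzero \<open>C p\<close>; finiteness comes from the newsvendor bound
        \<open>G p\<close>.\<close>
      have "C p < top" using order_trans[OF Cc c] by (rule order_le_less_trans) simp
      then have "C p / C p = 1" using C_pos[of p] elim by (intro ennreal_divide_self) auto
      then have "1 \<le> ?c / C p" using divide_right_mono_ennreal[OF Cc, of "C p"] by simp
      moreover have "?c / C p \<le> ennreal (G p / G (p / k))"
      proof (rule divide_le_posI_ennreal)
        have "?c \<le> ennreal (G (p / k)) * ennreal (G p / G (p / k))"
          using c elim by (simp add: ennreal_mult[symmetric])
        also have "\<dots> \<le> C p * ennreal (G p / G (p / k))"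
          using lower[of p] elim by (intro mult_right_mono) auto
        finally show "?c \<le> C p * ennreal (G p / G (p / k))" .
      qed (use C_pos elim in auto)
      ultimately show ?case ..
    qed
    have "((\<lambda>p. ennreal (G p / G (p / k))) \<longlongrightarrow> 1) at_top"
      using tendsto_ennrealI[OF ratio] by simp
    from tendsto_sandwich[OF _ _ tendsto_const this] bounds show ?thesis
      by (simp add: eventually_conj_iff)
  qed
  have "V p \<ge> 0" for p by (simp add: V_def)
  then show ?thesis
    using squeeze[of V] squeeze unfolding C_def V_def
    by (auto simp: is_arg_min_linorder)
qed

end
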